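(* When the sampling rule of the CTAS algorithm is run (without stopping), for every arm $a$, \[ \mathbb{P}_{\boldsymbol{\mu}\times\boldsymbol{c}}\left(\lim_{t\to\infty}\frac{\hat c_a(t)N_a(t)}{J(t)}=w_a^*\right)=1, \] where $w^*_a=w^*_a(\boldsymbol{\mu},\boldsymbol{c})$.
   Context: Setting: $K$ arms; arm $a$ has reward distribution $\nu_{\mu_a}$ in a one-parameter natural exponential family $\{h(x)\exp(\theta_\mu x-b(\theta_\mu))\}$ parametrized by the mean $\mu\in[0,1]$ ($b$ convex, twice differentiable) and cost distribution of mean $c_a$ supported in $[\ell,1]$, $\ell>0$; the best arm $\arg\max_a\mu_a$ is unique. At round $t$ the pulled arm $A_t$ yields independent reward $R_t\sim\nu_{\mu_{A_t}}$ and cost $C_t$. $d$ is the KL divergence within the family. $N_a(t)$: number of pulls of $a$ up to $t$; $\hat\mu_a(t),\hat c_a(t)$: empirical mean reward and cost; $J(t)=\sum_{k\le t}C_k$. For reward means $\boldsymbol{\mu}'$ with a unique best arm and positive cost means $\boldsymbol{c}'$, $\boldsymbol{w}^*(\boldsymbol{\mu}',\boldsymbol{c}')$ is the maximizer over the simplex $\Sigma_K$ of $\inf_{\boldsymbol{\lambda}:a^*(\boldsymbol{\lambda})\ne a^*(\boldsymbol{\mu}')}\sum_a\frac{w_a}{c'_a}d(\mu'_a,\lambda_a)$. CTAS sampling rule: pull each arm once; then at each time $t$, with $\mathcal{U}_t=\{a:N_a(t)<\sqrt t\}$ and $\hat{\boldsymbol{w}}^*(t)=\boldsymbol{w}^*(\hat{\boldsymbol{\mu}}(t),\hat{\boldsymbol{c}}(t))$,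 pull an arm in $\arg\min_aN_a(t)$ if $\mathcal{U}_t\neq\emptyset$, and otherwise an arm in $\arg\max_a(J(t)\hat w^*_a(t)-\hat c_a(t)N_a(t))$. *)

theory Defs
  imports "HOL-Probability.Probability" "HOL-Probability.Information"
begin

definition nef_measure ::
  "real measure \<Rightarrow> (real \<Rightarrow> real) \<Rightarrow> (real \<Rightarrow> real) \<Rightarrow> (real \<Rightarrow> real) \<Rightarrow> real \<Rightarrow> real measure" where
  "nef_measure \<rho> h b \<theta> m = density \<rho> (\<lambda>x. ennreal (h x * exp (\<theta> m * x - b (\<theta> m))))"

definition mean_param_nef ::
  "real measure \<Rightarrow> (real \<Rightarrow> real) \<Rightarrow> (real \<Rightarrow> real) \<Rightarrow> (real \<Rightarrow> real) \<Rightarrow> real set \<Rightarrow> bool" where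
  "mean_param_nef \<rho> h b \<theta> I \<longleftrightarrow>
     sets \<rho> = sets borel \<and> sigma_finite_measure \<rho> \<and>
     h \<in> borel_measurable borel \<and> (\<forall>x. 0 \<le> h x) \<and>
     open I \<and> is_interval I \<and> I \<noteq> {} \<and>
     (\<exists>\<Theta>. open \<Theta> \<and> is_interval \<Theta> \<and> \<theta> ` I \<subseteq> \<Theta> \<and> convex_on \<Theta> b \<and>
        (\<forall>x\<in>\<Theta>. b differentiable (at x) \<and> deriv b differentiable (at x))) \<and>
     (\<forall>m\<in>I. prob_space (nef_measure \<rho> h b \<theta> m) \<and>
        integrable (nef_measure \<rho> h b \<theta> m) (\<lambda>x. x) \<and>
        integral\<^sup>L (nef_measure \<rho> h b \<theta> m) (\<lambda>x. x) = m)"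

text \<open>d(m, l) = KL(nu_m || nu_l). Note KL_divergence b M N is the divergence of N from M.\<close>
definition nef_kl ::
  "real measure \<Rightarrow> (real \<Rightarrow> real) \<Rightarrow> (real \<Rightarrow> real) \<Rightarrow> (real \<Rightarrow> real) \<Rightarrow> real \<Rightarrow> real \<Rightarrow> real" where
  "nef_kl \<rho> h b \<theta> m l = KL_divergence (exp 1) (nef_measure \<rho> h b \<theta> l) (nef_measure \<rho> h b \<theta> m)"

definition unique_best :: "('k \<Rightarrow> real) \<Rightarrow> bool" where
  "unique_best \<mu> \<longleftrightarrow> (\<exists>a. \<forall>b. b \<noteq> a \<longrightarrow> \<mu> b < \<mu> a)"

definition best_arm :: "('k \<Rightarrow> real) \<Rightarrow> 'k" where
  "best_arm \<mu> = (THE a. \<forall>b. b \<noteq> a \<longrightarrow> \<mu> b < \<mu> a)"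

definition alt_set :: "real set \<Rightarrow> ('k \<Rightarrow> real) \<Rightarrow> ('k \<Rightarrow> real) set" where
  "alt_set I \<mu> = {l. (\<forall>a. l a \<in> I) \<and> unique_best l \<and> best_arm l \<noteq> best_arm \<mu>}"

definition prob_simplex :: "('k::finite \<Rightarrow> real) set" where
  "prob_simplex = {w. (\<forall>a. 0 \<le> w a) \<and> (\<Sum>a\<in>UNIV. w a) = 1}"

definition alloc_value ::
  "(real \<Rightarrow> real \<Rightarrow> real) \<Rightarrow> real set \<Rightarrow> ('k::finite \<Rightarrow> real) \<Rightarrow> ('k \<Rightarrow> real) \<Rightarrow> ('k \<Rightarrow> real) \<Rightarrow> real" where
  "alloc_value d I \<mu> c w = (INF l\<in>alt_set I \<mu>. \<Sum>a\<in>UNIV. w a / c a * d (\<mu> a) (l a))"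

definition is_optimal_alloc ::
  "(real \<Rightarrow> real \<Rightarrow> real) \<Rightarrow> real set \<Rightarrow> ('k::finite \<Rightarrow> real) \<Rightarrow> ('k \<Rightarrow> real) \<Rightarrow> ('k \<Rightarrow> real) \<Rightarrow> bool" where
  "is_optimal_alloc d I \<mu> c w \<longleftrightarrow>
     w \<in> prob_simplex \<and> (\<forall>v\<in>prob_simplex. alloc_value d I \<mu> c v \<le> alloc_value d I \<mu> c w)"

text \<open>A t is the arm pulled at round t (rounds are 1,2,...); X a n and Y a n are the reward and
  cost observed at the (n+1)-th pull of arm a.\<close>
definition pulls :: "(nat \<Rightarrow> 'k) \<Rightarrow> 'k \<Rightarrow> nat \<Rightarrow> nat" where
  "pulls A a t = card {s \<in> {1..t}. A s = a}"

definition obs :: "(nat \<Rightarrow> 'k) \<Rightarrow> ('k \<Rightarrow> nat \<Rightarrow> real) \<Rightarrow> nat \<Rightarrow> real" where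
  "obs A X s = X (A s) (pulls A (A s) (s - 1))"

definition emp_mean :: "(nat \<Rightarrow> 'k) \<Rightarrow> ('k \<Rightarrow> nat \<Rightarrow> real) \<Rightarrow> 'k \<Rightarrow> nat \<Rightarrow> real" where
  "emp_mean A X a t = (\<Sum>s\<in>{s \<in> {1..t}. A s = a}. obs A X s) / real (pulls A a t)"

definition total_cost :: "(nat \<Rightarrow> 'k) \<Rightarrow> ('k \<Rightarrow> nat \<Rightarrow> real) \<Rightarrow> nat \<Rightarrow> real" where
  "total_cost A Y t = (\<Sum>s\<in>{1..t}. obs A Y s)"

text \<open>W is the map (mu', c') |-> w*(mu', c'); A is any arm sequence obeying the CTAS
  sampling rule (with arbitrary tie-breaking).\<close>
definition ctas_rule ::
  "(('k::finite \<Rightarrow> real) \<Rightarrow> ('k \<Rightarrow> real) \<Rightarrow> ('k \<Rightarrow> real)) \<Rightarrow> ('k \<Rightarrow> nat \<Rightarrow> real) \<Rightarrow>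
   ('k \<Rightarrow> nat \<Rightarrow> real) \<Rightarrow> (nat \<Rightarrow> 'k) \<Rightarrow> bool" where
  "ctas_rule W X Y A \<longleftrightarrow>
     A ` {1..CARD('k)} = UNIV \<and>
     (\<forall>t\<ge>CARD('k).
        let N = (\<lambda>a. real (pulls A a t));
            muh = (\<lambda>a. emp_mean A X a t);
            ch = (\<lambda>a. emp_mean A Y a t);
            J = total_cost A Y t;
            wh = W muh ch
        in if {a. N a < sqrt (real t)} \<noteq> {}
           then (\<forall>b. N (A (Suc t)) \<le> N b)
           else (\<forall>b. J * wh b - ch b * N b \<le> J * wh (A (Suc t)) - ch (A (Suc t)) * N (A (Suc t))))"

end

theory Submission
  imports Defs "HOL-Probability.Hoeffding"
begin

text \<open>
  The divergence \<open>d\<close> is the Bregman divergence of \<open>f m = \<theta> m * m - b (\<theta> m)\<close>, whose gradient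
  \<open>\<theta>\<close> is strictly increasing and continuous on \<open>I\<close>. Hence the inner infimum over alternatives
  is the minimum, over the suboptimal arms \<open>a\<close>, of the value
  \<open>p d(\<mu>\<^sub>i, y) + q d(\<mu>\<^sub>a, y)\<close> at the weighted mean \<open>y\<close> of \<open>\<mu>\<^sub>i\<close> and \<open>\<mu>\<^sub>a\<close>, where \<open>i\<close> is the best
  arm, \<open>p = w\<^sub>i / c\<^sub>i\<close> and \<open>q = w\<^sub>a / c\<^sub>a\<close>. This value is homogeneous and concave in \<open>(p, q)\<close>,
  strictly so across rays, which makes the optimal allocation unique and, by compactness of the
  simplex, continuous in \<open>(\<mu>, c)\<close>.

  Forced exploration sends every number of pulls to infinity, so the empirical means converge by
  the strong law of large numbers and the plug-in allocations converge to \<open>w\<^sup>*\<close>. An arm pulled by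
  tracking has spent at most its target share of the total cost, hence the limit superior of each
  share is at most \<open>w\<^sup>*\<^sub>a\<close>; as shares and weights both sum to one, the shares converge.
\<close>

section \<open>Bregman divergences\<close>

text \<open>Nothing is assumed about the smoothness of \<open>f\<close>: nonnegativity of
  \<open>d\<close> makes \<open>\<theta>\<close> a subgradient of \<open>f\<close>, and this is all
  that the analysis of the infimum uses. All conditions are restricted to \<open>I\<close>, where
  the family lives.\<close>

locale bregman_divergence =
  fixes I :: "real set" and \<theta> f :: "real \<Rightarrow> real" and d :: "real \<Rightarrow> real \<Rightarrow> real"
  assumes open_I: "open I" and interval_I: "is_interval I"
    and \<theta>_strict_mono: "strict_mono_on I \<theta>" and \<theta>_cont: "continuous_on I \<theta>"
    and d_eq: "\<And>m l. m \<in> I \<Longrightarrow> l \<in> I \<Longrightarrow> d m l = f m - f l - \<theta> l * (m - l)"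
    and d_nonneg: "\<And>m l. m \<in> I \<Longrightarrow> l \<in> I \<Longrightarrow> 0 \<le> d m l"

begin

lemma segment_I:
  assumes "m \<in> I" "l \<in> I" "m \<le> x" "x \<le> l"
  shows "x \<in> I"
  using interval_I assms by (rule mem_is_interval_1_I)

lemma d_self [simp]: "m \<in> I \<Longrightarrow> d m m = 0"
  by (simp add: d_eq)

text \<open>The law of cosines for Bregman divergences: the values of \<open>f\<close> cancel and
  only a product of a gradient difference and a displacement is left over.\<close>

lemma d_three_point:
  assumes "m \<in> I" "x \<in> I" "l \<in> I"
  shows "d m l = d m x + d x l + (\<theta> l - \<theta> x) * (x - m)"
  using assms by (simp add: d_eq algebra_simps)

text \<open>The sign hypothesis expresses that \<open>x\<close> lies between \<open>m\<close> and
  \<open>l\<close>, in either order, so that both directions are served by one statement.\<close>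

lemma \<theta>_diff_mult_nonneg:
  assumes "x \<in> I" "l \<in> I" "0 \<le> (l - x) * (x - m)"
  shows "0 \<le> (\<theta> l - \<theta> x) * (x - m)"
proof (cases "l = x")
  case False
  then have "x < l \<and> m \<le> x \<or> l < x \<and> x \<le> m"
    using assms(3) unfolding zero_le_mult_iff by linarith
  then show ?thesis
  proof (elim disjE conjE)
    assume "x < l" "m \<le> x"
    then show ?thesis using strict_mono_onD[OF \<theta>_strict_mono assms(1,2)] by simp
  next
    assume "l < x" "x \<le> m"
    then show ?thesis using strict_mono_onD[OF \<theta>_strict_mono assms(2,1)] by (simp add: mult_nonpos_nonpos)
  qed
qed simp

lemma d_mono_between:
  assumes "m \<in> I" "x \<in> I" "l \<in> I" "0 \<le> (l - x) * (x - m)"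
  shows "d m x \<le> d m l"
  using d_three_point[OF assms(1-3)] \<theta>_diff_mult_nonneg[OF assms(2-4)] d_nonneg[OF assms(2,3)]
  by linarith

text \<open>Splitting at the midpoint makes the cross term of the three-point identity strictly
  positive, because \<open>\<theta>\<close> is strictly increasing; the two remaining divergences
  are nonnegative.\<close>

lemma d_pos:
  assumes "m \<in> I" "l \<in> I" "m \<noteq> l"
  shows "0 < d m l"
proof -
  define x where "x = (m + l) / 2"
  have x: "x \<in> I"
    using segment_I[OF assms(1,2), of x] segment_I[OF assms(2,1), of x] by (cases "m \<le> l") (auto simp: x_def)
  have "0 < (\<theta> l - \<theta> x) * (x - m)"
  proof (cases "m < l")
    case True
    then have "x < l" "m < x" by (auto simp: x_def)
    then show ?thesis using strict_mono_onD[OF \<theta>_strict_mono x assms(2)] by simp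
  next
    case False
    with assms(3) have "l < x" "x < m" by (auto simp: x_def)
    then show ?thesis using strict_mono_onD[OF \<theta>_strict_mono assms(2) x] by (simp add: mult_neg_neg)
  qed
  then show ?thesis
    using d_three_point[OF assms(1) x assms(2)] d_nonneg[OF assms(1) x] d_nonneg[OF x assms(2)] by linarith
qed

lemma tendsto_\<theta>: "m \<in> I \<Longrightarrow> (u \<longlongrightarrow> m) F \<Longrightarrow> ((\<lambda>t. \<theta> (u t)) \<longlongrightarrow> \<theta> m) F"
  using \<theta>_cont open_I by (metis continuous_on_eq_continuous_at isCont_tendsto_compose)

lemma eventually_I: "m \<in> I \<Longrightarrow> (u \<longlongrightarrow> m) F \<Longrightarrow> eventually (\<lambda>t. u t \<in> I) F"
  using open_I by (metis topological_tendstoD)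

text \<open>Continuity comes from the two subgradient inequalities between \<open>u t\<close> and
  \<open>m\<close>: the one with slope \<open>\<theta> m\<close> bounds \<open>f (u t)\<close> from
  below, the one with slope \<open>\<theta> (u t)\<close> from above.\<close>

lemma tendsto_f:
  assumes m: "m \<in> I" and u: "(u \<longlongrightarrow> m) F"
  shows "((\<lambda>t. f (u t)) \<longlongrightarrow> f m) F"
proof (rule tendsto_sandwich)
  show "\<forall>\<^sub>F t in F. f m + \<theta> m * (u t - m) \<le> f (u t)"
    using eventually_I[OF m u]
  proof eventually_elim
    case (elim t)
    then show ?case using d_nonneg[OF elim m] d_eq[OF elim m] by linarith
  qed
  show "\<forall>\<^sub>F t in F. f (u t) \<le> f m + \<theta> (u t) * (u t - m)"
    using eventually_I[OF m u]
  proof eventually_elim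
    case (elim t)
    then show ?case using d_nonneg[OF m elim] d_eq[OF m elim] by (simp add: algebra_simps)
  qed
  have "((\<lambda>t. f m + \<theta> m * (u t - m)) \<longlongrightarrow> f m + \<theta> m * (m - m)) F"
    by (intro tendsto_intros u)
  then show "((\<lambda>t. f m + \<theta> m * (u t - m)) \<longlongrightarrow> f m) F" by simp
  have "((\<lambda>t. f m + \<theta> (u t) * (u t - m)) \<longlongrightarrow> f m + \<theta> m * (m - m)) F"
    by (intro tendsto_intros tendsto_\<theta> m u)
  then show "((\<lambda>t. f m + \<theta> (u t) * (u t - m)) \<longlongrightarrow> f m) F" by simp
qed

lemma tendsto_d:
  assumes m: "m \<in> I" "(u \<longlongrightarrow> m) F" and l: "l \<in> I" "(v \<longlongrightarrow> l) F"
  shows "((\<lambda>t. d (u t) (v t)) \<longlongrightarrow> d m l) F"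
proof -
  have "((\<lambda>t. f (u t) - f (v t) - \<theta> (v t) * (u t - v t)) \<longlongrightarrow> f m - f l - \<theta> l * (m - l)) F"
    by (intro tendsto_intros tendsto_f tendsto_\<theta> m l)
  moreover have "\<forall>\<^sub>F t in F. f (u t) - f (v t) - \<theta> (v t) * (u t - v t) = d (u t) (v t)"
    using eventually_I[OF m] eventually_I[OF l] by eventually_elim (simp add: d_eq)
  ultimately show ?thesis
    using m l by (simp add: d_eq tendsto_cong)
qed

end

section \<open>Weighted means and the value of a pair of arms\<close>

definition bary :: "real \<Rightarrow> real \<Rightarrow> real \<Rightarrow> real \<Rightarrow> real" where
  "bary p q m n = (p * m + q * n) / (p + q)"

lemma bary_scale: "k \<noteq> 0 \<Longrightarrow> bary (k * p) (k * q) m n = bary p q m n"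
  by (simp add: bary_def mult.assoc flip: distrib_left)

lemma bary_diff:
  assumes "p + q > 0"
  shows "bary p q m n - m = q * (n - m) / (p + q)" "n - bary p q m n = p * (n - m) / (p + q)"
  using assms by (simp_all add: bary_def field_simps)

text \<open>Weights on different rays have different weighted means; this is where strictness in the
  concavity of the pair value originates.\<close>

lemma bary_eq_iff:
  assumes "p + q > 0" "p' + q' > 0" "m \<noteq> n"
  shows "bary p q m n = bary p' q' m n \<longleftrightarrow> p * q' = p' * q"
proof -
  have "bary p q m n = bary p' q' m n \<longleftrightarrow> q * (n - m) / (p + q) = q' * (n - m) / (p' + q')"
    using bary_diff(1)[OF assms(1), of m n] bary_diff(1)[OF assms(2), of m n] by linarith
  also have "\<dots> \<longleftrightarrow> q * (p' + q') * (n - m) = q' * (p + q) * (n - m)"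
    using assms by (simp add: frac_eq_eq mult.assoc mult.commute[of "n - m"])
  also have "\<dots> \<longleftrightarrow> p * q' = p' * q"
    using assms(3) by (auto simp: distrib_left mult.commute)
  finally show ?thesis .
qed

context bregman_divergence
begin

lemma bary_in_I:
  assumes "m \<in> I" "n \<in> I" "0 \<le> p" "0 \<le> q" "0 < p + q"
  shows "bary p q m n \<in> I"
proof -
  have "convex I" using interval_I by (simp add: is_interval_convex_1)
  then have "(p / (p + q)) *\<^sub>R m + (q / (p + q)) *\<^sub>R n \<in> I"
    using assms by (intro convexD) (auto simp: add_divide_distrib[symmetric])
  then show ?thesis by (simp add: bary_def add_divide_distrib)
qed

text \<open>For nonnegative weights this is the minimum over \<open>x\<close> in \<open>I\<close> of
  \<open>p * d m x + q * d n x\<close>, an unnormalised Jensen-Shannon divergence. For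
  \<open>p = q = 0\<close> the weighted mean is the default 0, possibly outside \<open>I\<close>,
  but its coefficients vanish.\<close>

definition pair_value :: "real \<Rightarrow> real \<Rightarrow> real \<Rightarrow> real \<Rightarrow> real" where
  "pair_value p q m n = p * d m (bary p q m n) + q * d n (bary p q m n)"

lemma pair_value_scale: "k \<noteq> 0 \<Longrightarrow> pair_value (k * p) (k * q) m n = k * pair_value p q m n"
  by (simp add: pair_value_def bary_scale algebra_simps)

text \<open>Summing the three-point identities at the weighted mean, the cross terms share the
  factor \<open>p * (y - m) + q * (y - n)\<close>, which is zero there. The remaining divergence to
  \<open>x\<close> shows that the weighted mean is the minimiser.\<close>

lemma compensation:
  assumes "m \<in> I" "n \<in> I" "x \<in> I" "0 \<le> p" "0 \<le> q" "0 < p + q"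
  shows "p * d m x + q * d n x = pair_value p q m n + (p + q) * d (bary p q m n) x"
proof -
  let ?y = "bary p q m n"
  have y: "?y \<in> I" by (rule bary_in_I) fact+
  have e: "p * (?y - m) + q * (?y - n) = 0"
    using assms by (simp add: bary_def field_simps)
  have "p * d m x + q * d n x
      = pair_value p q m n + (p + q) * d ?y x + (\<theta> x - \<theta> ?y) * (p * (?y - m) + q * (?y - n))"
    unfolding d_three_point[OF assms(1) y assms(3)] d_three_point[OF assms(2) y assms(3)]
    by (simp add: pair_value_def algebra_simps)
  then show ?thesis by (simp add: e)
qed

lemma pair_value_le:
  assumes "m \<in> I" "n \<in> I" "x \<in> I" "0 \<le> p" "0 \<le> q"
  shows "pair_value p q m n \<le> p * d m x + q * d n x"
proof (cases "p + q = 0")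
  case True
  then have "p = 0" "q = 0" using assms by auto
  then show ?thesis by (simp add: pair_value_def)
next
  case False
  then have pq: "0 < p + q" using assms by simp
  have "0 \<le> (p + q) * d (bary p q m n) x"
    using pq d_nonneg[OF bary_in_I[OF assms(1,2,4,5) pq] assms(3)] by simp
  then show ?thesis using compensation[OF assms pq] by simp
qed

lemma pair_value_attained:
  assumes "m \<in> I" "n \<in> I" "0 \<le> p" "0 \<le> q"
  obtains x where "x \<in> I" "pair_value p q m n = p * d m x + q * d n x"
proof (cases "p + q = 0")
  case True
  then have "p = 0" "q = 0" using assms by auto
  then show ?thesis using that[OF assms(1)] by (simp add: pair_value_def)
next
  case False
  then have pq: "0 < p + q" using assms by simp
  show ?thesis using that[OF bary_in_I[OF assms pq]] by (simp add: pair_value_def)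
qed

text \<open>Both pairs of weights are evaluated at the weighted mean of their sum. By compensation
  the gain is a weighted sum of the divergences from the two old means to the new one, and two
  distinct old means cannot both equal the new one. With homogeneity this is concavity.\<close>

lemma pair_value_superadd:
  assumes "m \<in> I" "n \<in> I" "0 < p" "0 < q" "0 < p'" "0 < q'"
  shows "pair_value p q m n + pair_value p' q' m n \<le> pair_value (p + p') (q + q') m n"
    and "m \<noteq> n \<Longrightarrow> p * q' \<noteq> p' * q \<Longrightarrow>
      pair_value p q m n + pair_value p' q' m n < pair_value (p + p') (q + q') m n"
proof -
  let ?y = "bary p q m n" and ?y' = "bary p' q' m n" and ?z = "bary (p + p') (q + q') m n"
  have pos: "0 < p + q" "0 < p' + q'" using assms by auto
  have I: "?y \<in> I" "?y' \<in> I" "?z \<in> I" by (intro bary_in_I; use assms in simp)+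
  have "pair_value (p + p') (q + q') m n = (p * d m ?z + q * d n ?z) + (p' * d m ?z + q' * d n ?z)"
    by (simp add: pair_value_def algebra_simps)
  also have "\<dots> = pair_value p q m n + (p + q) * d ?y ?z + (pair_value p' q' m n + (p' + q') * d ?y' ?z)"
    by (subst (1 2) compensation) (use assms I in auto)
  finally have eq: "pair_value (p + p') (q + q') m n
    = pair_value p q m n + pair_value p' q' m n + ((p + q) * d ?y ?z + (p' + q') * d ?y' ?z)"
    by simp
  have nn: "0 \<le> (p + q) * d ?y ?z" "0 \<le> (p' + q') * d ?y' ?z"
    using pos d_nonneg I by auto
  show "pair_value p q m n + pair_value p' q' m n \<le> pair_value (p + p') (q + q') m n"
    using eq nn by linarith
  assume "m \<noteq> n" "p * q' \<noteq> p' * q"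
  then have "?y \<noteq> ?y'" using bary_eq_iff[OF pos] by simp
  then have "0 < d ?y ?z \<or> 0 < d ?y' ?z" using d_pos I by metis
  then have "0 < (p + q) * d ?y ?z \<or> 0 < (p' + q') * d ?y' ?z" using pos mult_pos_pos by blast
  then show "pair_value p q m n + pair_value p' q' m n < pair_value (p + p') (q + q') m n"
    using eq nn by linarith
qed

text \<open>The minimiser for the larger weight is a competitor for the smaller one. It differs from
  \<open>m\<close> because \<open>n\<close> has positive weight, so lowering the weight of
  \<open>m\<close> strictly lowers the sum.\<close>

lemma pair_value_strict_mono:
  assumes "m \<in> I" "n \<in> I" "m \<noteq> n" "0 \<le> p" "p < p'" "0 < q"
  shows "pair_value p q m n < pair_value p' q m n"
proof -
  let ?y = "bary p' q m n"
  have pos: "0 < p' + q" using assms by simp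
  have y: "?y \<in> I" by (intro bary_in_I) (use assms in auto)
  have "?y \<noteq> m" using bary_diff(1)[OF pos, of m n] assms by auto
  then have "0 < (p' - p) * d m ?y" using d_pos[OF assms(1) y] assms by simp
  then have "p * d m ?y + q * d n ?y < pair_value p' q m n"
    by (simp add: pair_value_def algebra_simps)
  then show ?thesis using pair_value_le[OF assms(1,2) y, of p q] assms by simp
qed

lemma pair_value_pos:
  assumes "m \<in> I" "n \<in> I" "m \<noteq> n" "0 < p" "0 < q"
  shows "0 < pair_value p q m n"
proof -
  have "0 \<le> pair_value 0 q m n"
    by (rule pair_value_attained[of m n 0 q]) (use assms d_nonneg in auto)
  then show ?thesis using pair_value_strict_mono[of m n 0 p q] assms by simp
qed

lemma tendsto_pair_value:
  assumes "m \<in> I" "n \<in> I" "0 \<le> p" "0 \<le> q" "0 < p + q"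
    and lim: "(p' \<longlongrightarrow> p) F" "(q' \<longlongrightarrow> q) F" "(m' \<longlongrightarrow> m) F" "(n' \<longlongrightarrow> n) F"
  shows "((\<lambda>t. pair_value (p' t) (q' t) (m' t) (n' t)) \<longlongrightarrow> pair_value p q m n) F"
proof -
  have "((\<lambda>t. bary (p' t) (q' t) (m' t) (n' t)) \<longlongrightarrow> bary p q m n) F"
    unfolding bary_def using assms(5) by (intro tendsto_intros lim) simp
  then show ?thesis
    unfolding pair_value_def
    by (intro tendsto_intros tendsto_d lim bary_in_I assms)
qed

end

section \<open>The value of an allocation\<close>

lemma exists_other_arm:
  fixes i :: "'k::finite"
  assumes "CARD('k) \<ge> 2"
  obtains a where "a \<noteq> i"
proof -
  have "UNIV \<noteq> {i}"
  proof
    assume "UNIV = {i}"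
    then have "CARD('k) = card {i}" by (rule arg_cong)
    then show False using assms by simp
  qed
  then show ?thesis using that by blast
qed

lemma best_arm_eq: "(\<And>b. b \<noteq> i \<Longrightarrow> \<mu> b < \<mu> i) \<Longrightarrow> best_arm \<mu> = i"
  unfolding best_arm_def by (rule the_equality) (auto dest: less_asym)

lemma best_arm_less: "unique_best \<mu> \<Longrightarrow> b \<noteq> best_arm \<mu> \<Longrightarrow> \<mu> b < \<mu> (best_arm \<mu>)"
  using best_arm_eq[of _ \<mu>] unfolding unique_best_def by metis

lemma unique_bestI: "(\<And>b. b \<noteq> i \<Longrightarrow> \<mu> b < \<mu> i) \<Longrightarrow> unique_best \<mu>"
  unfolding unique_best_def by blast

lemma inj_imp_unique_best:
  fixes \<mu> :: "'k::finite \<Rightarrow> real"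
  assumes "inj \<mu>"
  shows "unique_best \<mu>"
proof -
  have "Max (range \<mu>) \<in> range \<mu>" by (rule Max_in) auto
  then obtain i where i: "Max (range \<mu>) = \<mu> i" by blast
  have "\<mu> b < \<mu> i" if "b \<noteq> i" for b
  proof -
    have "\<mu> b \<le> \<mu> i" using Max_ge[of "range \<mu>" "\<mu> b"] by (simp add: i)
    moreover have "\<mu> b \<noteq> \<mu> i" using assms that by (auto dest: injD)
    ultimately show ?thesis by simp
  qed
  then show ?thesis by (rule unique_bestI)
qed

text \<open>For each pair of arms, a tie of \<open>g\<close> is broken by \<open>e\<close> and a
  strict difference survives small perturbations; there are finitely many pairs. Injectivity yields
  the unique best arm that an alternative must have.\<close>

lemma eventually_inj_perturbation:
  fixes g e :: "'k::finite \<Rightarrow> real"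
  assumes "inj e"
  shows "\<forall>\<^sub>F t in at_right 0. inj (\<lambda>a. g a + t * e a)"
proof -
  have ne: "\<forall>\<^sub>F t in at_right 0. g a + t * e a \<noteq> g b + t * e b" if "a \<noteq> b" for a b
  proof (cases "g a = g b")
    case True
    have "e a \<noteq> e b" using assms that by (auto dest: injD)
    then show ?thesis
      using eventually_at_right_less[of "0::real"] by (auto simp: True elim!: eventually_mono)
  next
    case False
    have "((\<lambda>t. (g a + t * e a) - (g b + t * e b)) \<longlongrightarrow> (g a + 0 * e a) - (g b + 0 * e b)) (at_right 0)"
      by (intro tendsto_intros)
    then have "\<forall>\<^sub>F t in at_right 0. (g a + t * e a) - (g b + t * e b) \<noteq> 0"
      using False by (intro tendsto_imp_eventually_ne) auto
    then show ?thesis by eventually_elim simp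
  qed
  have "\<forall>\<^sub>F t in at_right 0. \<forall>a. \<forall>b. a \<noteq> b \<longrightarrow> g a + t * e a \<noteq> g b + t * e b"
  proof (intro eventually_all_finite)
    fix a b
    show "\<forall>\<^sub>F t in at_right 0. a \<noteq> b \<longrightarrow> g a + t * e a \<noteq> g b + t * e b"
      using ne[of a b] by (cases "a = b") simp_all
  qed
  then show ?thesis
    by eventually_elim (auto intro!: injI)
qed

context bregman_divergence
begin

text \<open>The cheapest way to bring arm \<open>a\<close> level with arm \<open>i\<close>: both
  means move to a common point and all other arms stay put.\<close>

definition arm_value :: "('k \<Rightarrow> real) \<Rightarrow> ('k \<Rightarrow> real) \<Rightarrow> ('k \<Rightarrow> real) \<Rightarrow> 'k \<Rightarrow> 'k \<Rightarrow> real" where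
  "arm_value \<mu> c w i a = pair_value (w i / c i) (w a / c a) (\<mu> i) (\<mu> a)"

lemma alloc_sum_nonneg:
  assumes "\<And>a. \<mu> a \<in> I" "\<And>a. l a \<in> I" "\<And>a. 0 < c a" "\<And>a. 0 \<le> w a"
  shows "0 \<le> (\<Sum>a\<in>A. w a / c a * d (\<mu> a) (l a))"
  using assms d_nonneg by (intro sum_nonneg mult_nonneg_nonneg divide_nonneg_pos) auto

text \<open>Putting arms \<open>i\<close> and \<open>a\<close> at the common mean \<open>x\<close>
  creates a tie and so is not an alternative itself. It is a limit of alternatives, which suffices
  for an infimum of a continuous function.\<close>

lemma alternatives_approx:
  fixes \<mu> :: "'k::finite \<Rightarrow> real"
  assumes \<mu>: "\<And>a. \<mu> a \<in> I" and best: "\<And>b. b \<noteq> i \<Longrightarrow> \<mu> b < \<mu> i" and a: "a \<noteq> i" and x: "x \<in> I"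
  obtains l where "\<And>b. ((\<lambda>t. l t b) \<longlongrightarrow> (\<mu>(i := x, a := x)) b) (at_right (0::real))"
    "\<forall>\<^sub>F t in at_right 0. l t \<in> alt_set I \<mu>"
proof -
  \<comment> \<open>An injective direction: arm \<open>i\<close> gets -1 and every other arm a
    nonnegative number, so \<open>a\<close> overtakes \<open>i\<close> at once.\<close>
  define e :: "'k \<Rightarrow> real" where "e b = (if b = i then -1 else real (to_nat b))" for b
  define g where "g = \<mu>(i := x, a := x)"
  have gI: "g b \<in> I" for b using \<mu> x by (simp add: g_def)
  have "inj e"
  proof (rule injI)
    fix u v assume "e u = e v"
    then show "u = v" by (auto simp: e_def split: if_splits)
  qed
  have lim: "((\<lambda>t. g b + t * e b) \<longlongrightarrow> g b) (at_right 0)" for b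
  proof -
    have "((\<lambda>t. g b + t * e b) \<longlongrightarrow> g b + 0 * e b) (at_right 0)" by (intro tendsto_intros)
    then show ?thesis by simp
  qed
  have "\<forall>\<^sub>F t in at_right 0. \<forall>b. g b + t * e b \<in> I"
    by (intro eventually_all_finite eventually_I[OF gI lim])
  then have "\<forall>\<^sub>F t in at_right 0. (\<lambda>b. g b + t * e b) \<in> alt_set I \<mu>"
    using eventually_inj_perturbation[OF \<open>inj e\<close>, of g] eventually_at_right_less[of "0::real"]
  proof eventually_elim
    case (elim t)
    let ?l = "\<lambda>b. g b + t * e b"
    have ub: "unique_best ?l" by (rule inj_imp_unique_best) fact
    have "- t < t * real (to_nat a)"
      using elim(3) mult_nonneg_nonneg[of t "real (to_nat a)"] by linarith
    then have "?l i < ?l a" using a by (simp add: g_def e_def)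
    then have "best_arm ?l \<noteq> i" using best_arm_less[OF ub, of a] by fastforce
    then show ?case using ub elim(1) best_arm_eq[of i \<mu>, OF best] by (simp add: alt_set_def)
  qed
  with lim show ?thesis by (intro that[of "\<lambda>t b. g b + t * e b"]) (auto simp: g_def)
qed

lemma bdd_below_alloc:
  assumes "\<And>a. \<mu> a \<in> I" "\<And>a. 0 < c a" "\<And>a. 0 \<le> w a"
  shows "bdd_below ((\<lambda>l. \<Sum>a\<in>UNIV. w a / c a * d (\<mu> a) (l a)) ` alt_set I \<mu>)"
  by (intro bdd_belowI2[of _ 0] alloc_sum_nonneg assms) (auto simp: alt_set_def)

text \<open>Each approximating alternative bounds the infimum, and the bound passes to the limit,
  where all arms except \<open>i\<close> and \<open>a\<close> keep their means and contribute
  zero.\<close>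

lemma alloc_value_le:
  fixes \<mu> :: "'k::finite \<Rightarrow> real"
  assumes \<mu>: "\<And>a. \<mu> a \<in> I" and best: "\<And>b. b \<noteq> i \<Longrightarrow> \<mu> b < \<mu> i"
    and c: "\<And>a. 0 < c a" and w: "\<And>a. 0 \<le> w a" and a: "a \<noteq> i" and x: "x \<in> I"
  shows "alloc_value d I \<mu> c w \<le> w i / c i * d (\<mu> i) x + w a / c a * d (\<mu> a) x"
proof -
  let ?g = "\<mu>(i := x, a := x)"
  obtain l where lim: "\<And>b. ((\<lambda>t. l t b) \<longlongrightarrow> ?g b) (at_right (0::real))"
    and alt: "\<forall>\<^sub>F t in at_right 0. l t \<in> alt_set I \<mu>"
    using alternatives_approx[of \<mu> i a x, OF \<mu> best a x] by blast
  have gI: "?g b \<in> I" for b using \<mu> x by simp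
  have "alloc_value d I \<mu> c w \<le> (\<Sum>b\<in>UNIV. w b / c b * d (\<mu> b) (?g b))"
  proof (rule tendsto_lowerbound)
    show "((\<lambda>t. \<Sum>b\<in>UNIV. w b / c b * d (\<mu> b) (l t b))
        \<longlongrightarrow> (\<Sum>b\<in>UNIV. w b / c b * d (\<mu> b) (?g b))) (at_right 0)"
      by (intro tendsto_sum tendsto_mult_left tendsto_d \<mu> gI lim tendsto_const)
    show "\<forall>\<^sub>F t in at_right 0. alloc_value d I \<mu> c w \<le> (\<Sum>b\<in>UNIV. w b / c b * d (\<mu> b) (l t b))"
      using alt
    proof eventually_elim
      case (elim t)
      then show ?case
        unfolding alloc_value_def by (intro cINF_lower bdd_below_alloc \<mu> c w)
    qed
  qed simp
  also have "\<dots> = (\<Sum>b\<in>{i, a}. w b / c b * d (\<mu> b) (?g b))"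
    by (intro sum.mono_neutral_right) (auto simp: \<mu>)
  also have "\<dots> = w i / c i * d (\<mu> i) x + w a / c a * d (\<mu> a) x"
    using a by simp
  finally show ?thesis .
qed

lemma pair_value_le_crossing:
  assumes "m \<in> I" "n \<in> I" "n < m" "0 \<le> p" "0 \<le> q" "u \<in> I" "v \<in> I" "u < v"
  shows "pair_value p q m n \<le> p * d m u + q * d n v"
proof -
  \<comment> \<open>The projection of \<open>u\<close> onto the interval from \<open>n\<close> to
    \<open>m\<close>. It lies between \<open>m\<close> and \<open>u\<close>, and, since
    \<open>u < v\<close>, also between \<open>n\<close> and \<open>v\<close>; hence neither
    divergence increases.\<close>
  define x where "x = max n (min m u)"
  have x: "x \<in> I" using assms by (auto simp: x_def max_def min_def)
  have "0 \<le> (u - x) * (x - m)" "0 \<le> (v - x) * (x - n)"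
    using assms by (auto simp: x_def max_def min_def zero_le_mult_iff)
  then have "d m x \<le> d m u" "d n x \<le> d n v" using d_mono_between assms x by auto
  then have "p * d m x + q * d n x \<le> p * d m u + q * d n v"
    using assms by (intro add_mono mult_left_mono)
  then show ?thesis using pair_value_le[OF assms(1,2) x assms(4,5)] by simp
qed

text \<open>The infimum equals the least \<open>arm_value\<close> over the arms other than
  \<open>i\<close>; lower bounds express this without a minimum over arms. One direction tests at
  the minimiser of each pair, the other looks at the best arm of an arbitrary alternative, which has
  crossed \<open>i\<close>.\<close>

lemma alloc_value_ge_iff:
  fixes \<mu> :: "'k::finite \<Rightarrow> real"
  assumes \<mu>: "\<And>a. \<mu> a \<in> I" and best: "\<And>b. b \<noteq> i \<Longrightarrow> \<mu> b < \<mu> i"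
    and c: "\<And>a. 0 < c a" and w: "\<And>a. 0 \<le> w a" and two: "CARD('k) \<ge> 2"
  shows "B \<le> alloc_value d I \<mu> c w \<longleftrightarrow> (\<forall>a. a \<noteq> i \<longrightarrow> B \<le> arm_value \<mu> c w i a)"
proof safe
  fix a assume B: "B \<le> alloc_value d I \<mu> c w" and a: "a \<noteq> i"
  obtain x where x: "x \<in> I" "arm_value \<mu> c w i a = w i / c i * d (\<mu> i) x + w a / c a * d (\<mu> a) x"
    unfolding arm_value_def
    by (rule pair_value_attained[OF \<mu>[of i] \<mu>[of a], of "w i / c i" "w a / c a"])
       (use c w in \<open>auto intro: divide_nonneg_pos\<close>)
  then show "B \<le> arm_value \<mu> c w i a"
    using alloc_value_le[of \<mu> i c w a x] assms a B by auto
next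
  assume B: "\<forall>a. a \<noteq> i \<longrightarrow> B \<le> arm_value \<mu> c w i a"
  obtain a where a: "a \<noteq> i" by (rule exists_other_arm[OF two])
  obtain l where "\<forall>\<^sub>F t in at_right (0::real). l t \<in> alt_set I \<mu>"
    using alternatives_approx[of \<mu> i a "\<mu> i", OF \<mu> best a \<mu>] by blast
  \<comment> \<open>A greatest-lower-bound argument for a real infimum requires a nonempty set of
    alternatives; a second arm provides one.\<close>
  then have ne: "alt_set I \<mu> \<noteq> {}"
    using eventually_happens'[OF trivial_limit_at_right_real] by blast
  show "B \<le> alloc_value d I \<mu> c w"
    unfolding alloc_value_def
  proof (rule cINF_greatest[OF ne])
    fix l assume "l \<in> alt_set I \<mu>"
    then have l: "\<And>a. l a \<in> I" "unique_best l" "best_arm l \<noteq> i"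
      using best_arm_eq[of i \<mu>, OF best] by (auto simp: alt_set_def)
    define a where "a = best_arm l"
    have a: "a \<noteq> i" "l i < l a" using l(3) best_arm_less[OF l(2), of i] by (auto simp: a_def)
    have "B \<le> w i / c i * d (\<mu> i) (l i) + w a / c a * d (\<mu> a) (l a)"
      using B a pair_value_le_crossing[OF \<mu> \<mu> best[OF a(1)] _ _ l(1) l(1) a(2), of "w i / c i" "w a / c a"] c w
      by (fastforce simp: arm_value_def intro: divide_nonneg_pos)
    also have "\<dots> = (\<Sum>b\<in>{i, a}. w b / c b * d (\<mu> b) (l b))"
      using a by simp
    also have "\<dots> \<le> (\<Sum>b\<in>UNIV. w b / c b * d (\<mu> b) (l b))"
      by (intro sum_mono2) (use c w d_nonneg[OF \<mu> l(1)] in \<open>auto intro!: mult_nonneg_nonneg divide_nonneg_pos\<close>)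
    finally show "B \<le> (\<Sum>b\<in>UNIV. w b / c b * d (\<mu> b) (l b))" .
  qed
qed

end

section \<open>Uniqueness and continuity of the optimal allocation\<close>

text \<open>Finitely many strict inequalities give a uniform gap, so that
  \<open>value_ge_iff\<close> can deliver strict improvement of the allocation value. Inserting
  \<open>B + 1\<close> keeps the minimum defined over a nonempty set.\<close>

lemma finite_arms_gap:
  fixes V :: "'k::finite \<Rightarrow> real"
  assumes "\<And>a. a \<noteq> i \<Longrightarrow> B < V a"
  obtains B' where "B < B'" "\<And>a. a \<noteq> i \<Longrightarrow> B' \<le> V a"
proof
  show "B < Min (insert (B + 1) (V ` (UNIV - {i})))"
    using assms by (subst Min_gr_iff) auto
  show "Min (insert (B + 1) (V ` (UNIV - {i}))) \<le> V a" if "a \<noteq> i" for a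
    using that by (intro Min_le) auto
qed

lemma prob_simplex_sum_eq:
  assumes "w \<in> prob_simplex" "w' \<in> prob_simplex" "\<And>a. w i * w' a = w' i * w a" "0 < w i"
  shows "w = (w' :: 'k::finite \<Rightarrow> real)"
proof -
  have "w i = w i * (\<Sum>a\<in>UNIV. w' a)" using assms(2) by (simp add: prob_simplex_def)
  also have "\<dots> = w' i * (\<Sum>a\<in>UNIV. w a)" by (simp add: sum_distrib_left assms(3))
  also have "\<dots> = w' i" using assms(1) by (simp add: prob_simplex_def)
  finally have eq: "w i = w' i" .
  show ?thesis
  proof
    fix a
    show "w a = w' a" using assms(3)[of a] assms(4) by (simp add: eq)
  qed
qed

lemma prob_simplex_convergent_subseq:
  fixes w :: "nat \<Rightarrow> 'k::finite \<Rightarrow> real"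
  assumes "\<And>n. w n \<in> prob_simplex"
  obtains r w' where "strict_mono (r :: nat \<Rightarrow> nat)" "w' \<in> prob_simplex" "\<And>a. (\<lambda>n. w (r n) a) \<longlonglongrightarrow> w' a"
proof -
  \<comment> \<open>Functions on arms are moved to the Euclidean space of vectors indexed by arms in
    order to apply Bolzano-Weierstrass.\<close>
  define z where "z n = (\<chi> a. w n a)" for n
  have "norm (z n) \<le> 1" for n
  proof -
    have "norm (z n) \<le> (\<Sum>a\<in>UNIV. \<bar>z n $ a\<bar>)" by (rule norm_le_l1_cart)
    also have "\<dots> = (\<Sum>a\<in>UNIV. w n a)" using assms[of n] by (simp add: z_def prob_simplex_def)
    also have "\<dots> = 1" using assms[of n] by (simp add: prob_simplex_def)
    finally show ?thesis .
  qed
  then have "bounded (range z)" by (auto simp: bounded_iff)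
  then obtain l r where r: "strict_mono r" and l: "(z \<circ> r) \<longlonglongrightarrow> l"
    using bounded_imp_convergent_subsequence by blast
  have lim: "(\<lambda>n. w (r n) a) \<longlonglongrightarrow> l $ a" for a
    using tendsto_vec_nth[OF l, of a] by (simp add: z_def o_def)
  have "0 \<le> l $ a" for a
    by (rule LIMSEQ_le_const[OF lim]) (use assms in \<open>auto simp: prob_simplex_def\<close>)
  moreover have "(\<Sum>a\<in>UNIV. l $ a) = 1"
  proof (rule LIMSEQ_unique)
    show "(\<lambda>n. \<Sum>a\<in>UNIV. w (r n) a) \<longlonglongrightarrow> (\<Sum>a\<in>UNIV. l $ a)" by (intro tendsto_sum lim)
    show "(\<lambda>n. \<Sum>a\<in>UNIV. w (r n) a) \<longlonglongrightarrow> 1" using assms by (simp add: prob_simplex_def)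
  qed
  ultimately have "($) l \<in> prob_simplex" by (simp add: prob_simplex_def)
  with r lim show ?thesis by (intro that) auto
qed

text \<open>The best arm is a parameter rather than \<open>best_arm \<mu>\<close>, so that perturbed
  means can be treated as instances with the same \<open>i\<close>.\<close>

locale bandit_instance = bregman_divergence +
  fixes \<mu> c :: "'k::finite \<Rightarrow> real" and i :: 'k
  assumes \<mu>_I: "\<And>a. \<mu> a \<in> I" and best: "\<And>b. b \<noteq> i \<Longrightarrow> \<mu> b < \<mu> i"
    and c_pos: "\<And>a. 0 < c a" and two_arms: "CARD('k) \<ge> 2"
begin

lemma value_ge_iff:
  "(\<And>a. 0 \<le> w a) \<Longrightarrow> B \<le> alloc_value d I \<mu> c w \<longleftrightarrow> (\<forall>a. a \<noteq> i \<longrightarrow> B \<le> arm_value \<mu> c w i a)"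
  using alloc_value_ge_iff[of \<mu> i c w B] \<mu>_I best c_pos two_arms by blast

lemma value_le_arm: "(\<And>a. 0 \<le> w a) \<Longrightarrow> a \<noteq> i \<Longrightarrow> alloc_value d I \<mu> c w \<le> arm_value \<mu> c w i a"
  using value_ge_iff by blast

lemma simplex_nonneg: "w \<in> prob_simplex \<Longrightarrow> 0 \<le> w a"
  by (simp add: prob_simplex_def)

lemma div_c_nonneg: "0 \<le> w a \<Longrightarrow> 0 \<le> w a / c a"
  using c_pos[of a] by simp

text \<open>The uniform allocation has positive value, hence so has an optimal one. If
  \<open>i\<close> or another arm \<open>b\<close> had no weight, moving it to the mean of the other
  would cost nothing and the value would be at most zero.\<close>

lemma optimal_pos:
  assumes opt: "is_optimal_alloc d I \<mu> c w"
  shows "0 < w a"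
proof -
  have w: "w \<in> prob_simplex" using opt by (simp add: is_optimal_alloc_def)
  note w0 = simplex_nonneg[OF w]
  define u :: "'k \<Rightarrow> real" where "u a = 1 / real CARD('k)" for a
  have u: "u \<in> prob_simplex" by (simp add: u_def prob_simplex_def)
  have "0 < arm_value \<mu> c u i a" if "a \<noteq> i" for a
    unfolding arm_value_def using best[OF that] c_pos \<mu>_I
    by (intro pair_value_pos) (auto simp: u_def)
  then obtain B where "0 < B" and "\<And>a. a \<noteq> i \<Longrightarrow> B \<le> arm_value \<mu> c u i a"
    by (rule finite_arms_gap) auto
  then have "0 < alloc_value d I \<mu> c u" using value_ge_iff[of u B] simplex_nonneg[OF u] by auto
  also have "\<dots> \<le> alloc_value d I \<mu> c w" using opt u by (simp add: is_optimal_alloc_def)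
  finally have pos: "0 < alloc_value d I \<mu> c w" .
  have both: "0 < w i \<and> 0 < w b" if b: "b \<noteq> i" for b
  proof -
    have le: "alloc_value d I \<mu> c w \<le> w i / c i * d (\<mu> i) x + w b / c b * d (\<mu> b) x" if "x \<in> I" for x
      by (rule alloc_value_le) (use that \<mu>_I best c_pos w0 b in auto)
    have "w i \<noteq> 0" using le[OF \<mu>_I[of b]] pos \<mu>_I by auto
    moreover have "w b \<noteq> 0" using le[OF \<mu>_I[of i]] pos \<mu>_I by auto
    ultimately show ?thesis using w0 by (simp add: less_le)
  qed
  obtain b where "b \<noteq> i" by (rule exists_other_arm[OF two_arms])
  with both show ?thesis by (cases "a = i") auto
qed

text \<open>The midpoint of two distinct optima strictly improves the value of some arm; moving a little
  weight from that arm to the best one then improves the values of all arms.\<close>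
lemma optimal_unique:
  assumes w: "is_optimal_alloc d I \<mu> c w" and w': "is_optimal_alloc d I \<mu> c w'"
  shows "w = w'"
proof (rule ccontr)
  assume "w \<noteq> w'"
  note pos = optimal_pos[OF w] optimal_pos[OF w']
  have simp: "w \<in> prob_simplex" "w' \<in> prob_simplex" using w w' by (auto simp: is_optimal_alloc_def)
  define F where "F = alloc_value d I \<mu> c w"
  have F': "F = alloc_value d I \<mu> c w'"
    using w w' by (intro antisym) (auto simp: is_optimal_alloc_def F_def)
  have F_le: "F \<le> arm_value \<mu> c w i a" "F \<le> arm_value \<mu> c w' i a" if "a \<noteq> i" for a
    using value_le_arm[of w a] value_le_arm[of w' a] that pos F' by (auto simp: F_def less_imp_le)
  have F_max: "alloc_value d I \<mu> c v \<le> F" if "v \<in> prob_simplex" for v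
    using w that by (simp add: is_optimal_alloc_def F_def)
  \<comment> \<open>Proportional points of the simplex coincide, so distinct optima have different
    weight ratios at some arm; strict superadditivity applies there.\<close>
  obtain a where a: "w i * w' a \<noteq> w' i * w a"
    using prob_simplex_sum_eq[OF simp, of i] pos(1) \<open>w \<noteq> w'\<close> by blast
  then have ai: "a \<noteq> i" by (auto simp: mult.commute)
  define r where "r b = (w b + w' b) / 2" for b
  have rpos: "0 < r b" for b using pos(1)[of b] pos(2)[of b] by (simp add: r_def)
  have "(\<Sum>a\<in>UNIV. r a) = 1"
    using simp by (simp add: r_def prob_simplex_def sum.distrib flip: sum_divide_distrib)
  have half: "arm_value \<mu> c r i b
      = (1 / 2) * pair_value (w i / c i + w' i / c i) (w b / c b + w' b / c b) (\<mu> i) (\<mu> b)" for b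
    unfolding arm_value_def by (subst pair_value_scale [symmetric]) (simp_all add: r_def add_divide_distrib mult.commute)
  have vpos: "0 < w b / c b" "0 < w' b / c b" for b using pos c_pos by auto
  have r_ge: "F \<le> arm_value \<mu> c r i b" if "b \<noteq> i" for b
    using pair_value_superadd(1)[OF \<mu>_I \<mu>_I vpos(1) vpos(1) vpos(2) vpos(2), of i b i b i b] F_le[OF that, unfolded arm_value_def]
    by (subst half) linarith
  have r_gt: "F < arm_value \<mu> c r i a"
  proof -
    have "w i / c i * (w' a / c a) \<noteq> w' i / c i * (w a / c a)"
      using a c_pos[of i] c_pos[of a] by (simp add: field_simps)
    then show ?thesis
      using pair_value_superadd(2)[OF \<mu>_I \<mu>_I vpos(1) vpos(1) vpos(2) vpos(2), of i a i a i a] F_le[OF ai, unfolded arm_value_def]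
        best[OF ai]
      by (subst half) linarith
  qed
  define s where "s t = r(i := r i + t, a := r a - t)" for t
  have "((\<lambda>t. arm_value \<mu> c (s t) i a) \<longlongrightarrow> arm_value \<mu> c r i a) (at_right 0)"
  proof -
    have "((\<lambda>t. s t b) \<longlongrightarrow> s 0 b) (at_right 0)" for b
      unfolding s_def fun_upd_def by (cases "b = a"; cases "b = i") (auto intro!: tendsto_eq_intros)
    moreover have "s 0 = r" by (simp add: s_def)
    ultimately have "((\<lambda>t. s t b) \<longlongrightarrow> r b) (at_right 0)" for b by simp
    then have lim: "((\<lambda>t. s t b / c b) \<longlongrightarrow> r b / c b) (at_right 0)" for b
      using c_pos[of b] by (intro tendsto_divide tendsto_const) auto
    show ?thesis
      unfolding arm_value_def using rpos c_pos
      by (intro tendsto_pair_value lim tendsto_const \<mu>_I add_pos_pos) (auto simp: less_imp_le)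
  qed
  \<comment> \<open>The strict gain at \<open>a\<close> survives a small transfer \<open>t\<close>;
    all other arms gain through the larger weight of \<open>i\<close>.\<close>
  then have "\<forall>\<^sub>F t in at_right 0. F < arm_value \<mu> c (s t) i a" using r_gt by (rule order_tendstoD)
  moreover have "\<forall>\<^sub>F t in at_right 0. t < r a"
    using rpos[of a] eventually_at_right_field by blast
  ultimately have "\<forall>\<^sub>F t in at_right 0. F < arm_value \<mu> c (s t) i a \<and> t < r a \<and> 0 < t"
    using eventually_at_right_less[of "0::real"] by eventually_elim auto
  then obtain t where t: "F < arm_value \<mu> c (s t) i a" "t < r a" "0 < t"
    using eventually_happens'[OF trivial_limit_at_right_real] by blast
  have "F < arm_value \<mu> c (s t) i b" if b: "b \<noteq> i" for b
  proof (cases "b = a")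
    case False
    have "arm_value \<mu> c r i b < arm_value \<mu> c (s t) i b"
      unfolding arm_value_def using False b ai t rpos c_pos best[OF b]
      by (simp add: s_def) (intro pair_value_strict_mono, auto intro!: \<mu>_I divide_strict_right_mono less_imp_le)
    then show ?thesis using r_ge[OF b] by simp
  qed (use t in simp)
  then obtain B where B: "F < B" "\<And>b. b \<noteq> i \<Longrightarrow> B \<le> arm_value \<mu> c (s t) i b"
    by (rule finite_arms_gap) auto
  have s_nonneg: "0 \<le> s t b" for b using t rpos[of b] rpos[of i] by (auto simp: s_def)
  have "(\<Sum>b\<in>UNIV. s t b) = (\<Sum>b\<in>UNIV. r b + (if b = i then t else 0) - (if b = a then t else 0))"
    using ai by (intro sum.cong) (auto simp: s_def)
  also have "\<dots> = 1" using \<open>(\<Sum>a\<in>UNIV. r a) = 1\<close> by (simp add: sum.distrib sum_subtractf)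
  finally have "s t \<in> prob_simplex" using s_nonneg by (simp add: prob_simplex_def)
  then have "alloc_value d I \<mu> c (s t) \<le> F" by (rule F_max)
  moreover have "B \<le> alloc_value d I \<mu> c (s t)" using value_ge_iff[of "s t" B] s_nonneg B by blast
  ultimately show False using B by simp
qed

text \<open>All requirements on an instance are finitely many open conditions, so nearby instances
  satisfy them with the same best arm.\<close>

lemma eventually_bandit_instance:
  assumes "\<And>a. ((\<lambda>t. \<mu>' t a) \<longlongrightarrow> \<mu> a) G" "\<And>a. ((\<lambda>t. c' t a) \<longlongrightarrow> c a) G"
  shows "\<forall>\<^sub>F t in G. bandit_instance I \<theta> f d (\<mu>' t) (c' t) i"
proof -
  have "\<forall>\<^sub>F t in G. \<forall>a. \<mu>' t a \<in> I"
    by (rule eventually_all_finite) (rule eventually_I[OF \<mu>_I assms(1)])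
  moreover have "\<forall>\<^sub>F t in G. \<forall>a. 0 < c' t a"
    by (rule eventually_all_finite) (rule order_tendstoD(1)[OF assms(2) c_pos])
  moreover have "\<forall>\<^sub>F t in G. \<forall>b. b \<noteq> i \<longrightarrow> \<mu>' t b < \<mu>' t i"
  proof (intro eventually_all_finite)
    fix b
    show "\<forall>\<^sub>F t in G. b \<noteq> i \<longrightarrow> \<mu>' t b < \<mu>' t i"
    proof (cases "b = i")
      case False
      have "((\<lambda>t. \<mu>' t i - \<mu>' t b) \<longlongrightarrow> \<mu> i - \<mu> b) G" by (intro tendsto_intros assms)
      then have "\<forall>\<^sub>F t in G. 0 < \<mu>' t i - \<mu>' t b"
        by (rule order_tendstoD) (use best[OF False] in simp)
      then show ?thesis by eventually_elim simp
    qed simp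
  qed
  ultimately show ?thesis
    by eventually_elim (unfold_locales, use two_arms in auto)
qed

text \<open>The optimal allocation has a closed graph. Weights of \<open>v'\<close> may vanish a
  priori, where continuity of the pair value is not at hand; the values of \<open>v n\<close> are
  therefore bounded at a fixed common point \<open>x\<close>, which gives an expression continuous
  in all arguments.\<close>

lemma optimal_limit:
  assumes lim: "\<And>a. (\<lambda>n. \<mu>' n a) \<longlonglongrightarrow> \<mu> a" "\<And>a. (\<lambda>n. c' n a) \<longlonglongrightarrow> c a" "\<And>a. (\<lambda>n. v n a) \<longlonglongrightarrow> v' a"
    and opt: "\<forall>\<^sub>F n in sequentially. is_optimal_alloc d I (\<mu>' n) (c' n) (v n)"
    and v': "v' \<in> prob_simplex" and w: "is_optimal_alloc d I \<mu> c w"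
  shows "v' = w"
proof -
  have wp: "0 < w a" for a by (rule optimal_pos[OF w])
  have ws: "w \<in> prob_simplex" using w by (simp add: is_optimal_alloc_def)
  have bi: "\<forall>\<^sub>F n in sequentially. bandit_instance I \<theta> f d (\<mu>' n) (c' n) i"
    by (rule eventually_bandit_instance[OF lim(1,2)])
  have c0: "c a \<noteq> 0" for a using c_pos[of a] by simp
  have lower: "B \<le> arm_value \<mu> c v' i a" if B: "B < alloc_value d I \<mu> c w" and a: "a \<noteq> i" for B a
  proof -
    have "\<forall>\<^sub>F n in sequentially. \<forall>b. b \<noteq> i \<longrightarrow> B < arm_value (\<mu>' n) (c' n) w i b"
    proof (intro eventually_all_finite)
      fix b
      show "\<forall>\<^sub>F n in sequentially. b \<noteq> i \<longrightarrow> B < arm_value (\<mu>' n) (c' n) w i b"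
      proof (cases "b = i")
        case False
        have "(\<lambda>n. arm_value (\<mu>' n) (c' n) w i b) \<longlonglongrightarrow> arm_value \<mu> c w i b"
          unfolding arm_value_def using wp c_pos
          by (intro tendsto_pair_value tendsto_divide lim tendsto_const \<mu>_I add_pos_pos c0) (auto simp: less_imp_le)
        moreover have "B < arm_value \<mu> c w i b"
          using B value_le_arm[of w b] False wp by (simp add: less_imp_le less_le_trans)
        ultimately have "\<forall>\<^sub>F n in sequentially. B < arm_value (\<mu>' n) (c' n) w i b" by (rule order_tendstoD)
        then show ?thesis by eventually_elim simp
      qed simp
    qed
    then have ev: "\<forall>\<^sub>F n in sequentially. B \<le> v n i / c' n i * d (\<mu>' n i) x + v n a / c' n a * d (\<mu>' n a) x"
      if "x \<in> I" for x
      using bi opt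
    proof eventually_elim
      case (elim n)
      interpret B: bandit_instance I \<theta> f d "\<mu>' n" "c' n" i by (rule elim(2))
      have "B \<le> alloc_value d I (\<mu>' n) (c' n) w"
        using B.value_ge_iff[of w B] wp elim(1) by (simp add: less_imp_le)
      also have "\<dots> \<le> alloc_value d I (\<mu>' n) (c' n) (v n)"
        using elim(3) ws by (simp add: is_optimal_alloc_def)
      also have "\<dots> \<le> v n i / c' n i * d (\<mu>' n i) x + v n a / c' n a * d (\<mu>' n a) x"
        by (rule alloc_value_le)
           (use that B.\<mu>_I B.best B.c_pos elim(3) a in \<open>auto simp: is_optimal_alloc_def prob_simplex_def\<close>)
      finally show ?case .
    qed
    \<comment> \<open>The point is the minimiser for the limiting weights, so the limit of the upper
      bounds is exactly the value of \<open>v'\<close> at arm \<open>a\<close>.\<close>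
    obtain x where x: "x \<in> I" "arm_value \<mu> c v' i a = v' i / c i * d (\<mu> i) x + v' a / c a * d (\<mu> a) x"
      unfolding arm_value_def
      by (rule pair_value_attained[OF \<mu>_I[of i] \<mu>_I[of a], of "v' i / c i" "v' a / c a"])
         (use div_c_nonneg simplex_nonneg[OF v'] in auto)
    have "(\<lambda>n. v n i / c' n i * d (\<mu>' n i) x + v n a / c' n a * d (\<mu>' n a) x) \<longlonglongrightarrow> arm_value \<mu> c v' i a"
      unfolding x(2) by (intro tendsto_intros lim tendsto_d \<mu>_I c0 x(1))
    then show ?thesis using ev[OF x(1)] by (rule tendsto_lowerbound) simp
  qed
  have "alloc_value d I \<mu> c w \<le> alloc_value d I \<mu> c v'"
    by (subst value_ge_iff) (use simplex_nonneg[OF v'] lower in \<open>auto intro: dense_le\<close>)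
  then have "is_optimal_alloc d I \<mu> c v'"
    using w v' by (auto simp: is_optimal_alloc_def intro: order_trans)
  then show ?thesis using optimal_unique w by blast
qed

text \<open>Compactness: a subsequence staying away from \<open>w\<close> has a further subsequence
  converging in the simplex, whose limit is optimal and hence equals \<open>w\<close>.\<close>

lemma optimal_continuous:
  assumes lim: "\<And>a. (\<lambda>n. \<mu>' n a) \<longlonglongrightarrow> \<mu> a" "\<And>a. (\<lambda>n. c' n a) \<longlonglongrightarrow> c a"
    and opt: "\<forall>\<^sub>F n in sequentially. is_optimal_alloc d I (\<mu>' n) (c' n) (v n)"
    and w: "is_optimal_alloc d I \<mu> c w"
  shows "(\<lambda>n. v n a) \<longlonglongrightarrow> w a"
proof (rule ccontr)
  assume "\<not> ?thesis"
  then obtain e where e: "e > 0" "\<not> (\<forall>\<^sub>F n in sequentially. dist (v n a) (w a) < e)"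
    unfolding tendsto_iff by blast
  obtain N where N: "\<And>n. n \<ge> N \<Longrightarrow> is_optimal_alloc d I (\<mu>' n) (c' n) (v n)"
    using opt unfolding eventually_sequentially by blast
  have "\<exists>n>m. n \<ge> N \<and> e \<le> dist (v n a) (w a)" for m
  proof -
    have "\<not> (\<forall>n\<ge>max (Suc m) N. dist (v n a) (w a) < e)"
      using e(2) unfolding eventually_sequentially by blast
    then obtain n where "n \<ge> max (Suc m) N" "\<not> dist (v n a) (w a) < e" by blast
    then show ?thesis by (intro exI[of _ n]) auto
  qed
  then have inf: "infinite {n. n \<ge> N \<and> e \<le> dist (v n a) (w a)}"
    unfolding infinite_nat_iff_unbounded mem_Collect_eq by (intro allI)
  define s where "s = enumerate {n. n \<ge> N \<and> e \<le> dist (v n a) (w a)}"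
  have s: "strict_mono s" "N \<le> s n" "e \<le> dist (v (s n) a) (w a)" for n
    using strict_mono_enumerate[OF inf] enumerate_in_set[OF inf, of n] unfolding s_def by simp_all
  have "v (s n) \<in> prob_simplex" for n using N[OF s(2)] by (simp add: is_optimal_alloc_def)
  then obtain r v' where r: "strict_mono r" "v' \<in> prob_simplex" "\<And>a. (\<lambda>n. v (s (r n)) a) \<longlonglongrightarrow> v' a"
    by (rule prob_simplex_convergent_subseq) (rule that)
  have sr: "strict_mono (s \<circ> r)" using s(1) r(1) by (rule strict_mono_o)
  have "v' = w"
  proof (rule optimal_limit[OF _ _ r(3) _ r(2) w])
    show "(\<lambda>n. \<mu>' (s (r n)) b) \<longlonglongrightarrow> \<mu> b" "(\<lambda>n. c' (s (r n)) b) \<longlonglongrightarrow> c b" for b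
      using LIMSEQ_subseq_LIMSEQ[OF lim(1) sr, of b] LIMSEQ_subseq_LIMSEQ[OF lim(2) sr, of b]
      by (simp_all add: o_def)
    show "\<forall>\<^sub>F n in sequentially. is_optimal_alloc d I (\<mu>' (s (r n))) (c' (s (r n))) (v (s (r n)))"
      by (intro always_eventually allI N s(2))
  qed
  then have "(\<lambda>n. dist (v (s (r n)) a) (w a)) \<longlonglongrightarrow> dist (w a) (w a)"
    using tendsto_dist[OF r(3)[of a] tendsto_const[of "w a"]] by (simp only:)
  then have "e \<le> dist (w a) (w a)"
    by (rule LIMSEQ_le_const) (intro exI allI impI s(3))
  then show False using e by simp
qed

end

section \<open>Exponential families\<close>

lemma density_real_mult:
  assumes "f \<in> borel_measurable M" "g \<in> borel_measurable M" "\<And>x. 0 \<le> (f x::real)"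
  shows "density (density M (\<lambda>x. ennreal (f x))) (\<lambda>x. ennreal (g x)) = density M (\<lambda>x. ennreal (f x * g x))"
  using assms by (simp add: density_density_eq ennreal_mult')

locale mean_nef =
  fixes \<rho> :: "real measure" and h b \<theta> :: "real \<Rightarrow> real" and I :: "real set"
  assumes nef: "mean_param_nef \<rho> h b \<theta> I"
begin

abbreviation "\<nu> \<equiv> nef_measure \<rho> h b \<theta>"

lemma
  shows sets_\<rho>: "sets \<rho> = sets borel" and \<rho>_sigma_finite: "sigma_finite_measure \<rho>"
    and h_meas: "h \<in> borel_measurable borel" and h_nonneg: "0 \<le> h x"
    and open_I: "open I" and interval_I: "is_interval I"
    and \<nu>_prob: "m \<in> I \<Longrightarrow> prob_space (\<nu> m)"
    and \<nu>_integrable: "m \<in> I \<Longrightarrow> integrable (\<nu> m) (\<lambda>x. x)"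
    and \<nu>_mean: "m \<in> I \<Longrightarrow> integral\<^sup>L (\<nu> m) (\<lambda>x. x) = m"
  using nef unfolding mean_param_nef_def by auto

lemma h_meas_\<rho> [measurable]: "h \<in> borel_measurable \<rho>"
  using h_meas sets_\<rho> measurable_cong_sets by blast

lemma id_meas_\<rho> [measurable]: "(\<lambda>x. x) \<in> borel_measurable \<rho>"
  using sets_\<rho> measurable_ident_sets by blast

lemma sets_\<nu> [measurable_cong]: "sets (\<nu> m) = sets borel"
  by (simp add: nef_measure_def sets_\<rho>)

lemma borel_measurable_\<nu> [simp]: "borel_measurable (\<nu> m) = borel_measurable borel"
  by (intro measurable_cong_sets sets_\<nu> refl)

text \<open>Exponential tilting: the factor \<open>h\<close> is common to all members, so each is a
  density with respect to any other, positive everywhere.\<close>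

lemma \<nu>_change:
  "\<nu> l = density (\<nu> m) (\<lambda>x. ennreal (exp ((\<theta> l - \<theta> m) * x - (b (\<theta> l) - b (\<theta> m)))))"
proof -
  have e: "exp (\<theta> m * x - b (\<theta> m)) * exp ((\<theta> l - \<theta> m) * x - (b (\<theta> l) - b (\<theta> m)))
      = exp (\<theta> l * x - b (\<theta> l))" for x
    by (simp add: exp_add [symmetric] algebra_simps)
  show ?thesis
    unfolding nef_measure_def
    by (subst density_real_mult) (auto simp: h_nonneg mult.assoc e)
qed

text \<open>This is the total mass one of \<open>\<nu> l\<close>, written through the tilt of
  \<open>\<nu> m\<close>.\<close>

lemma mgf:
  assumes "l \<in> I"
  shows "(\<integral>\<^sup>+x. ennreal (exp ((\<theta> l - \<theta> m) * x)) \<partial>\<nu> m) = ennreal (exp (b (\<theta> l) - b (\<theta> m)))"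
proof -
  let ?c = "exp (b (\<theta> l) - b (\<theta> m))"
  interpret l: prob_space "\<nu> l" by (rule \<nu>_prob) fact
  have "1 = emeasure (\<nu> l) (space (\<nu> l))" by (simp add: l.emeasure_space_1)
  also have "\<dots> = (\<integral>\<^sup>+x. 1 \<partial>\<nu> l)" by simp
  also have "\<dots> = (\<integral>\<^sup>+x. ennreal (exp ((\<theta> l - \<theta> m) * x - (b (\<theta> l) - b (\<theta> m)))) \<partial>\<nu> m)"
    by (subst \<nu>_change[of l m], subst nn_integral_density) auto
  finally have 1: "(\<integral>\<^sup>+x. ennreal (exp ((\<theta> l - \<theta> m) * x - (b (\<theta> l) - b (\<theta> m)))) \<partial>\<nu> m) = 1"
    by simp
  have "(\<integral>\<^sup>+x. ennreal (exp ((\<theta> l - \<theta> m) * x)) \<partial>\<nu> m)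
      = (\<integral>\<^sup>+x. ennreal ?c * ennreal (exp ((\<theta> l - \<theta> m) * x - (b (\<theta> l) - b (\<theta> m)))) \<partial>\<nu> m)"
    by (intro nn_integral_cong) (simp add: ennreal_mult' [symmetric] exp_add [symmetric])
  also have "\<dots> = ennreal ?c"
    by (subst nn_integral_cmult) (auto simp: 1)
  finally show ?thesis .
qed

text \<open>The Legendre transform of the log-partition function \<open>b\<close>, evaluated in the
  mean coordinate.\<close>

definition f :: "real \<Rightarrow> real" where "f m = \<theta> m * m - b (\<theta> m)"

text \<open>The Bregman form of the divergence. \<open>D m l\<close> is also the logarithm of the
  moment generating function of the centred \<open>\<nu> m\<close> at
  \<open>\<theta> l - \<theta> m\<close>, from which its sign and the properties of
  \<open>\<theta>\<close> are derived.\<close>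

definition D :: "real \<Rightarrow> real \<Rightarrow> real" where "D m l = f m - f l - \<theta> l * (m - l)"

lemma mgf_centered:
  assumes "m \<in> I" "l \<in> I"
  shows "integrable (\<nu> m) (\<lambda>x. exp ((\<theta> l - \<theta> m) * (x - m)))"
    and "integral\<^sup>L (\<nu> m) (\<lambda>x. exp ((\<theta> l - \<theta> m) * (x - m))) = exp (D m l)"
proof -
  have "(\<integral>\<^sup>+x. ennreal (exp ((\<theta> l - \<theta> m) * (x - m))) \<partial>\<nu> m)
      = (\<integral>\<^sup>+x. ennreal (exp (- (\<theta> l - \<theta> m) * m)) * ennreal (exp ((\<theta> l - \<theta> m) * x)) \<partial>\<nu> m)"
    by (intro nn_integral_cong)
       (simp add: ennreal_mult' [symmetric] exp_add [symmetric] algebra_simps)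
  also have "\<dots> = ennreal (exp (- (\<theta> l - \<theta> m) * m)) * ennreal (exp (b (\<theta> l) - b (\<theta> m)))"
    by (subst nn_integral_cmult) (auto simp: mgf assms)
  also have "\<dots> = ennreal (exp (D m l))"
    by (simp add: ennreal_mult' [symmetric] exp_add [symmetric] D_def f_def algebra_simps)
  finally have *: "(\<integral>\<^sup>+x. ennreal (exp ((\<theta> l - \<theta> m) * (x - m))) \<partial>\<nu> m) = ennreal (exp (D m l))" .
  then show "integrable (\<nu> m) (\<lambda>x. exp ((\<theta> l - \<theta> m) * (x - m)))"
    by (intro integrableI_nonneg) auto
  show "integral\<^sup>L (\<nu> m) (\<lambda>x. exp ((\<theta> l - \<theta> m) * (x - m))) = exp (D m l)"
    using * by (intro integral_eq_nn_integral [THEN trans]) auto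
qed

lemma centered_integral:
  assumes "m \<in> I"
  shows "integrable (\<nu> m) (\<lambda>x. 1 + s * (x - m))" "integral\<^sup>L (\<nu> m) (\<lambda>x. 1 + s * (x - m)) = 1"
proof -
  interpret prob_space "\<nu> m" by (rule \<nu>_prob) fact
  show "integrable (\<nu> m) (\<lambda>x. 1 + s * (x - m))" 
    using \<nu>_integrable[OF assms] by auto
  show "integral\<^sup>L (\<nu> m) (\<lambda>x. 1 + s * (x - m)) = 1"
    using \<nu>_integrable[OF assms] \<nu>_mean[OF assms] by (simp add: prob_space)
qed

text \<open>Integrate \<open>1 + y \<le> exp y\<close> with \<open>y\<close> the centred variable
  times \<open>\<theta> l - \<theta> m\<close>; the left side has integral one.\<close>

lemma D_nonneg:
  assumes "m \<in> I" "l \<in> I"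
  shows "0 \<le> D m l"
proof -
  have "integral\<^sup>L (\<nu> m) (\<lambda>x. 1 + (\<theta> l - \<theta> m) * (x - m)) \<le> exp (D m l)"
    unfolding mgf_centered(2)[OF assms, symmetric]
    by (intro integral_mono centered_integral mgf_centered assms) auto
  then show ?thesis by (simp add: centered_integral assms)
qed

lemma D_add: "D m l + D l m = (\<theta> m - \<theta> l) * (m - l)"
  by (simp add: D_def algebra_simps)

text \<open>The symmetrised divergence is nonnegative, which gives monotonicity; equal natural
  parameters would give equal measures and hence equal means.\<close>

lemma \<theta>_strict_mono: "strict_mono_on I \<theta>"
proof (rule strict_mono_onI)
  fix m l assume ml: "m \<in> I" "l \<in> I" "m < l"
  have "\<theta> m \<noteq> \<theta> l"
  proof
    assume "\<theta> m = \<theta> l"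
    then have "\<nu> m = \<nu> l" by (simp add: nef_measure_def)
    then show False using \<nu>_mean ml by (metis less_irrefl)
  qed
  moreover have "0 \<le> (\<theta> m - \<theta> l) * (m - l)"
    using D_add[of m l] D_nonneg ml by (metis add_nonneg_nonneg)
  then have "\<theta> m \<le> \<theta> l" using ml by (simp add: zero_le_mult_iff)
  ultimately show "\<theta> m < \<theta> l" by simp
qed

text \<open>Tilting preserves null sets, so a point mass at \<open>m\<close> would force every
  member to be that point mass, while \<open>I\<close> is open and contains a second mean.\<close>

lemma \<nu>_not_dirac:
  assumes "m \<in> I"
  shows "\<not> (AE x in \<nu> m. x = m)"
proof
  assume dirac: "AE x in \<nu> m. x = m"
  obtain e where e: "e > 0" "ball m e \<subseteq> I" using open_I assms openE by blast
  define l where "l = m + e / 2"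
  have l: "l \<in> I" "l \<noteq> m" using e by (auto simp: l_def dist_real_def)
  interpret l: prob_space "\<nu> l" by (rule \<nu>_prob) fact
  have "AE x in \<nu> l. x = m"
    using dirac by (subst \<nu>_change[of l m], subst AE_density) auto
  then have "integral\<^sup>L (\<nu> l) (\<lambda>x. x) = integral\<^sup>L (\<nu> l) (\<lambda>x. m)"
    by (intro integral_cong_AE) auto
  then show False using \<nu>_mean l by (simp add: l.prob_space)
qed

text \<open>A jump of \<open>\<theta>\<close> at \<open>m\<close> would make the log-moment generating function of
  \<open>\<nu> m\<close> linear on a nontrivial interval, so that \<open>\<nu> m\<close> would be a point mass.\<close>
lemma \<theta>_no_jump:
  assumes m: "m \<in> I" and s: "s \<noteq> 0"
    and lim: "\<And>n. l n \<in> I" "l \<longlonglongrightarrow> m"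
    and jump: "\<And>n. \<bar>s\<bar> \<le> \<bar>\<theta> (l n) - \<theta> m\<bar>" "\<And>n. \<bar>\<theta> (l n) - \<theta> m\<bar> \<le> C"
    and sgn: "\<And>n. 0 < s * (\<theta> (l n) - \<theta> m)"
  shows False
proof -
  interpret prob_space "\<nu> m" by (rule \<nu>_prob) fact
  let ?g = "\<lambda>x. exp (s * (x - m))"
  \<comment> \<open>Since \<open>s\<close> lies between 0 and the increment of
    \<open>\<theta>\<close>, the exponential at \<open>s\<close> is bounded by a convex combination
    of those at 0 and at the increment.\<close>
  have conv: "?g x \<le> 1 + \<bar>s\<bar> / \<bar>\<theta> (l n) - \<theta> m\<bar> * (exp ((\<theta> (l n) - \<theta> m) * (x - m)) - 1)" for x n
  proof -
    define t where "t = \<theta> (l n) - \<theta> m"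
    define r where "r = \<bar>s\<bar> / \<bar>t\<bar>"
    have t: "t \<noteq> 0" "\<bar>s\<bar> \<le> \<bar>t\<bar>" "0 < s * t" using jump(1)[of n] sgn[of n] s by (auto simp: t_def)
    have r: "0 \<le> r" "r \<le> 1" using t by (auto simp: r_def divide_simps)
    have "s > 0 \<and> t > 0 \<or> s < 0 \<and> t < 0" using t(3) zero_less_mult_iff by blast
    then have rt: "r * t = s" by (elim disjE) (auto simp: r_def abs_of_neg)
    have "s * (x - m) = (1 - r) *\<^sub>R 0 + r *\<^sub>R (t * (x - m))"
      unfolding rt [symmetric] by (simp add: mult.assoc)
    then have "?g x = exp ((1 - r) *\<^sub>R 0 + r *\<^sub>R (t * (x - m)))" by (rule arg_cong)
    also have "\<dots> \<le> (1 - r) * exp 0 + r * exp (t * (x - m))"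
      using r by (intro convex_onD[OF exp_convex]) auto
    finally show ?thesis unfolding t_def [symmetric] r_def [symmetric] by (simp add: algebra_simps)
  qed
  have Dlim: "(\<lambda>n. D m (l n)) \<longlonglongrightarrow> 0"
  proof (rule Lim_null_comparison)
    show "\<forall>\<^sub>F n in sequentially. norm (D m (l n)) \<le> C * \<bar>m - l n\<bar>"
    proof (intro always_eventually allI)
      fix n
      have "D m (l n) \<le> (\<theta> m - \<theta> (l n)) * (m - l n)"
        using D_add[of m "l n"] D_nonneg[OF lim(1) m, of n] by simp
      also have "\<dots> \<le> \<bar>\<theta> m - \<theta> (l n)\<bar> * \<bar>m - l n\<bar>"
        by (simp only: abs_mult [symmetric] abs_ge_self)
      also have "\<dots> \<le> C * \<bar>m - l n\<bar>"
        using jump(2)[of n] by (intro mult_right_mono) (auto simp: abs_minus_commute)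
      finally show "norm (D m (l n)) \<le> C * \<bar>m - l n\<bar>" using D_nonneg[OF m lim(1), of n] by simp
    qed
    have "(\<lambda>n. C * \<bar>m - l n\<bar>) \<longlonglongrightarrow> C * \<bar>m - m\<bar>"
      by (intro tendsto_intros lim)
    then show "(\<lambda>n. C * \<bar>m - l n\<bar>) \<longlonglongrightarrow> 0" by simp
  qed
  have cint: "integrable (\<nu> m) (\<lambda>x. 1 + \<bar>s\<bar> / \<bar>\<theta> (l n) - \<theta> m\<bar> * (exp ((\<theta> (l n) - \<theta> m) * (x - m)) - 1))" for n
    by (intro Bochner_Integration.integrable_add integrable_mult_right Bochner_Integration.integrable_diff
        mgf_centered m lim) auto
  have gint: "integrable (\<nu> m) ?g"
  proof (rule Bochner_Integration.integrable_bound[OF cint[of 0]])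
    show "AE x in \<nu> m. norm (?g x)
        \<le> norm (1 + \<bar>s\<bar> / \<bar>\<theta> (l 0) - \<theta> m\<bar> * (exp ((\<theta> (l 0) - \<theta> m) * (x - m)) - 1))"
      unfolding real_norm_def abs_exp_cancel
      by (intro always_eventually allI order.trans[OF conv abs_ge_self])
  qed simp
  have bound: "integral\<^sup>L (\<nu> m) ?g \<le> exp (D m (l n))" for n
  proof -
    have "integral\<^sup>L (\<nu> m) ?g \<le> integral\<^sup>L (\<nu> m) 
      (\<lambda>x. 1 + \<bar>s\<bar> / \<bar>\<theta> (l n) - \<theta> m\<bar> * (exp ((\<theta> (l n) - \<theta> m) * (x - m)) - 1))"
      by (intro integral_mono gint cint conv)
    also have "\<dots> = 1 + \<bar>s\<bar> / \<bar>\<theta> (l n) - \<theta> m\<bar> * (exp (D m (l n)) - 1)"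
      using mgf_centered[OF m lim(1), of n] by (simp add: prob_space)
    also have "\<dots> \<le> 1 + 1 * (exp (D m (l n)) - 1)"
      using jump(1)[of n] s D_nonneg[OF m lim(1), of n]
      by (intro add_left_mono mult_right_mono) (auto simp: divide_simps)
    finally show ?thesis by simp
  qed
  have "(\<lambda>n. exp (D m (l n))) \<longlonglongrightarrow> exp 0" by (intro tendsto_intros Dlim)
  then have le1: "integral\<^sup>L (\<nu> m) ?g \<le> 1"
    using LIMSEQ_le_const[where a = "integral\<^sup>L (\<nu> m) ?g"] bound by fastforce
  \<comment> \<open>The integrand is nonnegative and its integral is at most zero, so equality holds
    almost everywhere in \<open>1 + y \<le> exp y\<close>; this happens only at
    \<open>y = 0\<close>.\<close>
  have "integral\<^sup>L (\<nu> m) (\<lambda>x. ?g x - (1 + s * (x - m))) = integral\<^sup>L (\<nu> m) ?g - 1"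
    using centered_integral[OF m, of s] gint by (subst Bochner_Integration.integral_diff) auto
  moreover have "0 \<le> integral\<^sup>L (\<nu> m) (\<lambda>x. ?g x - (1 + s * (x - m)))"
    by (intro integral_nonneg_AE always_eventually allI) simp
  ultimately have "integral\<^sup>L (\<nu> m) (\<lambda>x. ?g x - (1 + s * (x - m))) = 0" using le1 by simp
  moreover have "integrable (\<nu> m) (\<lambda>x. ?g x - (1 + s * (x - m)))"
    by (intro Bochner_Integration.integrable_diff gint centered_integral m)
  ultimately have "AE x in \<nu> m. ?g x - (1 + s * (x - m)) = 0"
    using integral_nonneg_eq_0_iff_AE[of "\<nu> m" "\<lambda>x. ?g x - (1 + s * (x - m))"] by simp
  then have "AE x in \<nu> m. x = m"
  proof eventually_elim
    case (elim x)
    show ?case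
    proof (rule ccontr)
      assume "x \<noteq> m"
      then have "s * (x - m) \<noteq> 0" using s by simp
      then have "1 + s * (x - m) < exp (s * (x - m))" using exp_minus_greater[of "- (s * (x - m))"] by simp
      with elim show False by simp
    qed
  qed
  with \<nu>_not_dirac[OF m] show False ..
qed


text \<open>A monotone function can fail to be continuous only through a jump on one side. The sign
  \<open>\<sigma>\<close> selects the side, and \<open>\<theta>_no_jump\<close> supplies points
  arbitrarily close in value on both.\<close>

lemma \<theta>_cont: "continuous_on I \<theta>"
proof (subst continuous_on_eq_continuous_at[OF open_I], safe)
  fix m assume m: "m \<in> I"
  obtain r where r: "r > 0" "cball m r \<subseteq> I" using open_I m open_contains_cball by blast
  have mono: "\<theta> x \<le> \<theta> y" if "x \<in> I" "y \<in> I" "x \<le> y" for x y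
    using \<theta>_strict_mono that by (metis strict_mono_onD le_less)
  have "\<exists>l\<in>I. 0 < \<sigma> * (l - m) \<and> \<bar>\<theta> l - \<theta> m\<bar> < e" if e: "e > 0" and \<sigma>: "\<sigma> = 1 \<or> \<sigma> = -1" for e \<sigma> :: real
  proof (rule ccontr)
    assume "\<not> ?thesis"
    then have far: "e \<le> \<bar>\<theta> l - \<theta> m\<bar>" if "l \<in> I" "0 < \<sigma> * (l - m)" for l
      using that by (meson not_less)
    \<comment> \<open>The sequence approaches \<open>m\<close> from the chosen side within radius
      \<open>r\<close>; by monotonicity the value of \<open>\<theta>\<close> at the endpoint
      \<open>m + \<sigma> * r\<close> bounds all increments.\<close>
    define l where "l n = m + \<sigma> * (r / real (Suc n))" for n
    have lr: "\<bar>l n - m\<bar> \<le> r" and lI: "l n \<in> I" and ls: "0 < \<sigma> * (l n - m)" for n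
    proof -
      show "\<bar>l n - m\<bar> \<le> r" using r \<sigma> by (auto simp: l_def divide_simps)
      then show "l n \<in> I" using r by (auto simp: dist_real_def)
      show "0 < \<sigma> * (l n - m)" using r \<sigma> by (auto simp: l_def)
    qed
    have rI: "m + \<sigma> * r \<in> I" using r \<sigma> by (auto simp: dist_real_def)
    have lim: "l \<longlonglongrightarrow> m"
    proof -
      have "l \<longlonglongrightarrow> m + \<sigma> * 0"
        unfolding l_def by (intro tendsto_intros LIMSEQ_Suc[OF lim_const_over_n])
      then show ?thesis by simp
    qed
    show False
    proof (rule \<theta>_no_jump[OF m _ lI lim, where s = "\<sigma> * e" and C = "\<bar>\<theta> (m + \<sigma> * r) - \<theta> m\<bar>"])
      show "\<sigma> * e \<noteq> 0" using e \<sigma> by auto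
      fix n
      show "\<bar>\<sigma> * e\<bar> \<le> \<bar>\<theta> (l n) - \<theta> m\<bar>" using far[OF lI ls, of n] e \<sigma> by (auto simp: abs_mult)
      show "\<bar>\<theta> (l n) - \<theta> m\<bar> \<le> \<bar>\<theta> (m + \<sigma> * r) - \<theta> m\<bar>"
        using \<sigma> lr[of n] ls[of n] mono[OF lI rI, of n] mono[OF m lI, of n] 
          mono[OF lI m, of n] mono[OF rI lI, of n] by auto
      show "0 < \<sigma> * e * (\<theta> (l n) - \<theta> m)"
        using \<sigma> e ls[of n] strict_mono_onD[OF \<theta>_strict_mono m lI, of n]
          strict_mono_onD[OF \<theta>_strict_mono lI m, of n] by (auto simp: zero_less_mult_iff mult_less_0_iff)
    qed
  qed note near = this
  show "isCont \<theta> m"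
    unfolding continuous_at_eps_delta
  proof safe
    fix e :: real assume e: "e > 0"
    obtain u where u: "u \<in> I" "u > m" "\<bar>\<theta> u - \<theta> m\<bar> < e" using near[OF e, of 1] by auto
    obtain v where v: "v \<in> I" "v < m" "\<bar>\<theta> v - \<theta> m\<bar> < e" using near[OF e, of "-1"] by auto
    show "\<exists>\<delta>>0. \<forall>x. dist x m < \<delta> \<longrightarrow> dist (\<theta> x) (\<theta> m) < e"
    proof (intro exI[of _ "min r (min (u - m) (m - v))"] conjI allI impI)
      show "min r (min (u - m) (m - v)) > 0" using r u v by simp
      fix x assume x: "dist x m < min r (min (u - m) (m - v))"
      then have "x \<in> I" using r by (auto simp: dist_commute)
      moreover have "v \<le> x" "x \<le> u" using x by (auto simp: dist_real_def)
      ultimately have "\<theta> v \<le> \<theta> x" "\<theta> x \<le> \<theta> u" using mono u v by auto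
      then show "dist (\<theta> x) (\<theta> m) < e" using u v by (auto simp: dist_real_def)
    qed
  qed
qed

text \<open>The logarithm of the density ratio is affine in \<open>x\<close>, so its integral under
  \<open>\<nu> m\<close> is its value at the mean. Where \<open>h\<close> vanishes, both integrands
  are zero.\<close>

lemma nef_kl_eq:
  assumes "m \<in> I" "l \<in> I"
  shows "nef_kl \<rho> h b \<theta> m l = D m l"
proof -
  interpret sigma_finite_measure \<rho> by (rule \<rho>_sigma_finite)
  interpret m: prob_space "\<nu> m" by (rule \<nu>_prob) fact
  let ?p = "\<lambda>m x. h x * exp (\<theta> m * x - b (\<theta> m))"
  let ?g = "\<lambda>x. (\<theta> m - \<theta> l) * x - (b (\<theta> m) - b (\<theta> l))"
  have "nef_kl \<rho> h b \<theta> m l = (\<integral>x. ?p m x * log (exp 1) (?p m x / ?p l x) \<partial>\<rho>)"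
    unfolding nef_kl_def nef_measure_def by (subst KL_density_density) (auto simp: h_nonneg)
  also have "\<dots> = (\<integral>x. ?p m x * ?g x \<partial>\<rho>)"
  proof (intro Bochner_Integration.integral_cong refl)
    fix x
    show "?p m x * log (exp 1) (?p m x / ?p l x) = ?p m x * ?g x"
    proof (cases "h x = 0")
      case False
      then have "?p m x / ?p l x = exp (?g x)"
        by (simp add: exp_diff [symmetric] algebra_simps)
      then show ?thesis by (simp add: log_def)
    qed simp
  qed
  also have "\<dots> = integral\<^sup>L (\<nu> m) ?g"
    unfolding nef_measure_def by (subst integral_density) (auto simp: h_nonneg)
  also have "\<dots> = (\<theta> m - \<theta> l) * m - (b (\<theta> m) - b (\<theta> l))"
    using \<nu>_integrable[OF assms(1)] \<nu>_mean[OF assms(1)] by (simp add: m.prob_space)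
  finally show ?thesis by (simp add: D_def f_def algebra_simps)
qed

lemma bregman: "bregman_divergence I \<theta> f (nef_kl \<rho> h b \<theta>)"
  by unfold_locales
     (auto simp: open_I interval_I \<theta>_strict_mono \<theta>_cont nef_kl_eq D_nonneg, simp add: D_def)

end

section \<open>Strong law of large numbers\<close>

context prob_space begin

text \<open>Markov's inequality and independence bound the probability of the bad event by
  \<open>r ^ n\<close>, and Borel-Cantelli concludes. The sign of \<open>s\<close> decides which
  tail is controlled.\<close>

lemma AE_sum_below_Chernoff:
  fixes X :: "nat \<Rightarrow> 'a \<Rightarrow> real"
  assumes indep: "indep_vars (\<lambda>_. borel) X UNIV"
    and mgf: "\<And>i. (\<integral>\<^sup>+\<omega>. ennreal (exp (s * (X i \<omega> - u))) \<partial>M) \<le> ennreal r" and r: "0 \<le> r" "r < 1"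
  shows "AE \<omega> in M. \<forall>\<^sub>F n in sequentially. s * ((\<Sum>i<n. X i \<omega>) - real n * u) < 0"
proof -
  have [measurable]: "X i \<in> borel_measurable M" for i
    using indep by (auto simp: indep_vars_def)
  let ?E = "\<lambda>n \<omega>. ennreal (exp (s * ((\<Sum>i<n. X i \<omega>) - real n * u)))"
  define B where "B n = {\<omega> \<in> space M. 1 \<le> 1 * ?E n \<omega>}" for n
  have [measurable]: "B n \<in> sets M" for n unfolding B_def by measurable
  have em: "emeasure M (B n) \<le> ennreal (r ^ n)" for n
  proof -
    have "emeasure M (B n) \<le> 1 * (\<integral>\<^sup>+\<omega>. ?E n \<omega> * indicator (space M) \<omega> \<partial>M)"
      unfolding B_def by (rule nn_integral_Markov_inequality) auto
    also have "\<dots> = (\<integral>\<^sup>+\<omega>. (\<Prod>i<n. ennreal (exp (s * (X i \<omega> - u)))) \<partial>M)"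
    proof -
      have "s * ((\<Sum>i<n. X i \<omega>) - real n * u) = (\<Sum>i<n. s * (X i \<omega> - u))" for \<omega>
        by (simp only: sum_distrib_left [symmetric] sum_subtractf) simp
      then have "?E n \<omega> = (\<Prod>i<n. ennreal (exp (s * (X i \<omega> - u))))" for \<omega>
        by (simp add: prod_ennreal exp_sum)
      then show ?thesis by (simp cong: nn_integral_cong)
    qed
    also have "\<dots> = (\<Prod>i<n. \<integral>\<^sup>+\<omega>. ennreal (exp (s * (X i \<omega> - u))) \<partial>M)"
      by (intro indep_vars_nn_integral indep_vars_compose2[OF indep_vars_subset[OF indep]]) auto
    also have "\<dots> \<le> (\<Prod>i<n. ennreal r)" by (intro prod_mono_ennreal mgf)
    also have "\<dots> = ennreal (r ^ n)" using r by (simp add: ennreal_power)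
    finally show ?thesis .
  qed
  have "AE \<omega> in M. \<forall>\<^sub>F n in sequentially. \<omega> \<in> space M - B n"
  proof (rule borel_cantelli_AE1)
    show "summable (\<lambda>n. measure M (B n))"
    proof (rule summable_comparison_test')
      show "summable (\<lambda>n. r ^ n)" using r by (intro summable_geometric) auto
      show "norm (measure M (B n)) \<le> r ^ n" for n
        using em[of n] r by (simp add: emeasure_eq_measure ennreal_le_iff)
    qed
  qed (auto simp: emeasure_eq_measure)
  then show ?thesis
    by eventually_elim (auto simp: B_def not_le elim!: eventually_mono)
qed

text \<open>Both tails are controlled through \<open>\<sigma>\<close>; the accuracies are restricted
  to the reciprocals of positive integers so that countably many null sets are united.\<close>

lemma AE_average_tendsto_Chernoff:
  fixes X :: "nat \<Rightarrow> 'a \<Rightarrow> real"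
  assumes indep: "indep_vars (\<lambda>_. borel) X UNIV"
    and mgf: "\<And>e \<sigma>. e > 0 \<Longrightarrow> \<sigma> = 1 \<or> \<sigma> = -1 \<Longrightarrow>
      \<exists>s r. \<sigma> * s > 0 \<and> 0 \<le> r \<and> r < 1 \<and>
        (\<forall>i. (\<integral>\<^sup>+\<omega>. ennreal (exp (s * (X i \<omega> - (m + \<sigma> * e)))) \<partial>M) \<le> ennreal r)"
  shows "AE \<omega> in M. (\<lambda>n. (\<Sum>i<n. X i \<omega>) / real n) \<longlonglongrightarrow> m"
proof -
  have one: "AE \<omega> in M. \<forall>\<^sub>F n in sequentially. \<sigma> * ((\<Sum>i<n. X i \<omega>) / real n - m) < e"
    if e: "e > 0" and \<sigma>: "\<sigma> = 1 \<or> \<sigma> = -1" for e \<sigma> :: real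
  proof -
    obtain s r where sr: "\<sigma> * s > 0" "0 \<le> r" "r < 1"
        "\<And>i. (\<integral>\<^sup>+\<omega>. ennreal (exp (s * (X i \<omega> - (m + \<sigma> * e)))) \<partial>M) \<le> ennreal r"
      using mgf[OF e \<sigma>] by blast
    have "AE \<omega> in M. \<forall>\<^sub>F n in sequentially. s * ((\<Sum>i<n. X i \<omega>) - real n * (m + \<sigma> * e)) < 0"
      by (rule AE_sum_below_Chernoff[OF indep sr(4,2,3)])
    then show ?thesis
    proof eventually_elim
      case (elim \<omega>)
      from elim eventually_gt_at_top[of 0] show ?case
      proof eventually_elim
        case (elim n)
        define S where "S = (\<Sum>i<n. X i \<omega>)"
          have S: "S / real n - m = (S - real n * m) / real n" using elim by (simp add: field_simps)
          from \<sigma> show ?case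
          proof
            assume [simp]: "\<sigma> = 1"
            have "S - real n * (m + e) < 0"
              using elim sr(1) unfolding S_def [symmetric] by (simp add: mult_less_0_iff)
            then have "S - real n * m < real n * e" by (simp add: algebra_simps)
            then show ?thesis using elim unfolding S_def [symmetric] S by (simp add: divide_simps mult.commute)
          next
            assume [simp]: "\<sigma> = -1"
            have "S - real n * (m - e) > 0"
              using elim sr(1) unfolding S_def [symmetric] by (simp add: mult_less_0_iff)
            then have "- (S - real n * m) < real n * e" by (simp add: algebra_simps)
            then have "- (S - real n * m) / real n < e" using elim by (simp add: divide_less_eq mult.commute)
            then show ?thesis unfolding S_def [symmetric] S by simp
          qed
      qed
    qed
  qed
  have "AE \<omega> in M. \<forall>k. \<forall>\<^sub>F n in sequentially. \<bar>(\<Sum>i<n. X i \<omega>) / real n - m\<bar> < inverse (real (Suc k))"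
  proof (subst AE_all_countable, intro allI)
    fix k
    have e: "inverse (real (Suc k)) > 0" by simp
    show "AE \<omega> in M. \<forall>\<^sub>F n in sequentially. \<bar>(\<Sum>i<n. X i \<omega>) / real n - m\<bar> < inverse (real (Suc k))"
      using one[OF e disjI1[OF refl]] one[OF e disjI2[OF refl]]
    proof eventually_elim
      case (elim \<omega>)
      then have "\<forall>\<^sub>F n in sequentially. 1 * ((\<Sum>i<n. X i \<omega>) / real n - m) < inverse (real (Suc k))"
        "\<forall>\<^sub>F n in sequentially. - 1 * ((\<Sum>i<n. X i \<omega>) / real n - m) < inverse (real (Suc k))"
        by auto
      then show ?case by eventually_elim (simp add: abs_less_iff del: of_nat_Suc)
    qed
  qed
  then show ?thesis
  proof eventually_elim
    case (elim \<omega>)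
    show ?case
    proof (rule tendstoI)
      fix e :: real assume "e > 0"
      then obtain k where k: "inverse (real (Suc k)) < e" using reals_Archimedean by blast
      show "\<forall>\<^sub>F n in sequentially. dist ((\<Sum>i<n. X i \<omega>) / real n) m < e"
        using elim[rule_format, of k] by eventually_elim (use k in \<open>simp add: dist_real_def\<close>)
    qed
  qed
qed

lemma AE_average_tendsto_unit_interval:
  fixes X :: "nat \<Rightarrow> 'a \<Rightarrow> real"
  assumes indep: "indep_vars (\<lambda>_. borel) X UNIV"
    and bdd: "\<And>i. AE \<omega> in M. X i \<omega> \<in> {0..1}" and mean: "\<And>i. expectation (X i) = m"
  shows "AE \<omega> in M. (\<lambda>n. (\<Sum>i<n. X i \<omega>) / real n) \<longlonglongrightarrow> m"
proof (rule AE_average_tendsto_Chernoff[OF indep])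
  fix e \<sigma> :: real assume e: "e > 0" and \<sigma>: "\<sigma> = 1 \<or> \<sigma> = -1"
  have [measurable]: "X i \<in> borel_measurable M" for i
    using indep by (auto simp: indep_vars_def)
  have b: "(\<integral>\<^sup>+\<omega>. ennreal (exp (\<sigma> * e * (X i \<omega> - (m + \<sigma> * e)))) \<partial>M) \<le> ennreal (exp (- (e\<^sup>2 / 2)))" for i
  proof -
    \<comment> \<open>The variable \<open>\<sigma> * X i\<close> lies in a unit interval starting at
      0 or -1. Hoeffding's lemma at parameter \<open>e\<close> then gives the exponent
      \<open>- e\<^sup>2 + e\<^sup>2 / 8\<close>, which is below
      \<open>- e\<^sup>2 / 2\<close>.\<close>
    define a where "a = (if \<sigma> = 1 then 0 else -1 :: real)"
    interpret Z: interval_bounded_random_variable M "\<lambda>\<omega>. \<sigma> * X i \<omega>" a "a + 1"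
    proof unfold_locales
      show "AE \<omega> in M. \<sigma> * X i \<omega> \<in> {a..a + 1}"
        using bdd[of i] by eventually_elim (use \<sigma> in \<open>auto simp: a_def\<close>)
    qed simp
    have mean': "expectation (\<lambda>\<omega>. \<sigma> * X i \<omega>) = \<sigma> * m" using mean by simp
    have "(\<integral>\<^sup>+\<omega>. ennreal (exp (\<sigma> * e * (X i \<omega> - (m + \<sigma> * e)))) \<partial>M)
      = (\<integral>\<^sup>+\<omega>. ennreal (exp (- (e\<^sup>2))) * ennreal (exp (e * (\<sigma> * X i \<omega> - \<sigma> * m))) \<partial>M)"
    proof (intro nn_integral_cong)
      fix \<omega>
      have "\<sigma> * e * (X i \<omega> - (m + \<sigma> * e)) = - (e\<^sup>2) + e * (\<sigma> * X i \<omega> - \<sigma> * m)"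
        using \<sigma> by (auto simp: algebra_simps power2_eq_square)
      then show "ennreal (exp (\<sigma> * e * (X i \<omega> - (m + \<sigma> * e))))
          = ennreal (exp (- (e\<^sup>2))) * ennreal (exp (e * (\<sigma> * X i \<omega> - \<sigma> * m)))"
        by (simp only: exp_add ennreal_mult' [OF exp_ge_zero])
    qed
    also have "\<dots> = ennreal (exp (- (e\<^sup>2))) * (\<integral>\<^sup>+\<omega>. ennreal (exp (e * (\<sigma> * X i \<omega> - \<sigma> * m))) \<partial>M)"
      by (subst nn_integral_cmult) auto
    also have "\<dots> \<le> ennreal (exp (- (e\<^sup>2))) * ennreal (exp (e\<^sup>2 * (a + 1 - a)\<^sup>2 / 8))"
      using Z.Hoeffdings_lemma_nn_integral[OF e] unfolding mean' by (intro mult_left_mono) auto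
    also have "\<dots> \<le> ennreal (exp (- (e\<^sup>2 / 2)))"
      by (simp add: ennreal_mult' [symmetric] mult_exp_exp ennreal_leI)
    finally show ?thesis .
  qed
  show "\<exists>s r. \<sigma> * s > 0 \<and> 0 \<le> r \<and> r < 1 \<and>
        (\<forall>i. (\<integral>\<^sup>+\<omega>. ennreal (exp (s * (X i \<omega> - (m + \<sigma> * e)))) \<partial>M) \<le> ennreal r)"
  proof (intro exI conjI allI)
    show "\<sigma> * (\<sigma> * e) > 0" using e \<sigma> by auto
    show "exp (- (e\<^sup>2 / 2)) < 1" using e by simp
    show "0 \<le> exp (- (e\<^sup>2 / 2))" by simp
  qed (rule b)
qed

text \<open>Serves to extract the sequence of one arm from the independent family indexed by arms
  and pull numbers.\<close>

lemma indep_vars_reindex: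
  assumes indep: "indep_vars N X (g ` J)" and inj: "inj_on g J"
  shows "indep_vars (\<lambda>j. N (g j)) (\<lambda>j. X (g j)) J"
proof -
  let ?F = "\<lambda>i. {X i -` A \<inter> space M |A. A \<in> sets (N i)}"
  have rv: "\<forall>i\<in>g ` J. random_variable (N i) (X i)" and F: "indep_sets ?F (g ` J)"
    using indep unfolding indep_vars_def2 by auto
  have "indep_sets (\<lambda>j. ?F (g j)) J"
  proof (rule indep_setsI)
    show "?F (g j) \<subseteq> events" if "j \<in> J" for j
      using rv that by (auto intro: measurable_sets)
    fix B K assume K: "K \<noteq> {}" "K \<subseteq> J" "finite K" and B: "\<forall>j\<in>K. B j \<in> ?F (g j)"
    have injK: "inj_on g K" using inj K(2) by (rule inj_on_subset)
    define B' where "B' i = B (the_inv_into K g i)" for i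
    have B': "B' (g j) = B j" if "j \<in> K" for j
      using the_inv_into_f_f[OF injK that] by (simp add: B'_def)
    have "prob (\<Inter>i\<in>g ` K. B' i) = (\<Prod>i\<in>g ` K. prob (B' i))"
      by (rule indep_setsD[OF F]) (use K B B' in auto)
    then show "prob (\<Inter>j\<in>K. B j) = (\<Prod>j\<in>K. prob (B j))"
      by (simp add: prod.reindex[OF injK] B')
  qed
  then show ?thesis using rv unfolding indep_vars_def2 by auto
qed

end

text \<open>The Chernoff parameter is the tilt from \<open>\<nu> m\<close> to a member
  \<open>\<nu> l\<close> with \<open>l\<close> strictly between \<open>m\<close> and the threshold
  \<open>u\<close>. The exponent \<open>s * (l - u) - D l m\<close> is then negative.\<close>

lemma (in mean_nef) AE_average_tendsto:
  fixes X :: "nat \<Rightarrow> 'w \<Rightarrow> real"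
  assumes M: "prob_space M" and indep: "prob_space.indep_vars M (\<lambda>_. borel) X UNIV"
    and distr: "\<And>n. distr M borel (X n) = \<nu> m" and m: "m \<in> I"
  shows "AE \<omega> in M. (\<lambda>n. (\<Sum>j<n. X j \<omega>) / real n) \<longlonglongrightarrow> m"
proof -
  interpret prob_space M by (rule M)
  have X [measurable]: "X n \<in> borel_measurable M" for n using indep by (auto simp: indep_vars_def)
  show ?thesis
  proof (rule AE_average_tendsto_Chernoff[OF indep])
    fix e \<sigma> :: real assume e: "e > 0" and \<sigma>: "\<sigma> = 1 \<or> \<sigma> = -1"
    obtain r where r: "r > 0" "ball m r \<subseteq> I" using open_I m openE by blast
    \<comment> \<open>The threshold may lie outside \<open>I\<close>; the tilted mean must stay
      inside and strictly before it.\<close>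
    define \<delta> where "\<delta> = min e r / 2"
    have \<delta>: "0 < \<delta>" "\<delta> < e" "\<delta> < r" using e r by (auto simp: \<delta>_def min_def)
    define l where "l = m + \<sigma> * \<delta>"
    have l: "l \<in> I" using r \<delta> \<sigma> by (auto simp: l_def dist_real_def intro!: subsetD[OF r(2)])
    define s where "s = \<theta> l - \<theta> m"
    have s: "\<sigma> * s > 0"
      using \<sigma> \<delta> strict_mono_onD[OF \<theta>_strict_mono m l] strict_mono_onD[OF \<theta>_strict_mono l m]
      by (auto simp: l_def s_def)
    define u where "u = m + \<sigma> * e"
    have "s * (l - u) = - ((\<sigma> * s) * (e - \<delta>))" by (simp add: l_def u_def algebra_simps)
    also have "\<dots> < 0" using s \<delta> by simp
    finally have neg: "s * (l - u) - D l m < 0" using D_nonneg[OF l m] by linarith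
    have "(\<integral>\<^sup>+\<omega>. ennreal (exp (s * (X n \<omega> - u))) \<partial>M) = ennreal (exp (s * (l - u) - D l m))" for n
    proof -
      have "(\<integral>\<^sup>+\<omega>. ennreal (exp (s * (X n \<omega> - u))) \<partial>M)
          = (\<integral>\<^sup>+x. ennreal (exp (s * (x - u))) \<partial>distr M borel (X n))"
        by (subst nn_integral_distr) auto
      also have "\<dots> = (\<integral>\<^sup>+x. ennreal (exp (- s * u)) * ennreal (exp (s * x)) \<partial>\<nu> m)"
        unfolding distr by (intro nn_integral_cong) (simp add: ennreal_mult' [symmetric] mult_exp_exp algebra_simps)
      also have "\<dots> = ennreal (exp (- s * u)) * ennreal (exp (b (\<theta> l) - b (\<theta> m)))"
        unfolding s_def by (subst nn_integral_cmult) (auto simp: mgf l)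
      also have "\<dots> = ennreal (exp (s * (l - u) - D l m))"
        by (simp add: ennreal_mult' [symmetric] mult_exp_exp D_def f_def s_def algebra_simps)
      finally show ?thesis .
    qed
    then show "\<exists>s r. \<sigma> * s > 0 \<and> 0 \<le> r \<and> r < 1 \<and>
        (\<forall>i. (\<integral>\<^sup>+\<omega>. ennreal (exp (s * (X i \<omega> - (m + \<sigma> * e)))) \<partial>M) \<le> ennreal r)"
      using s neg unfolding u_def [symmetric]
      by (intro exI[of _ s] exI[of _ "exp (s * (l - u) - D l m)"]) simp
  qed
qed

section \<open>Forced exploration and tracking\<close>

lemma pulls_0 [simp]: "pulls A a 0 = 0"
  by (simp add: pulls_def)

lemma rounds_Suc:
  "{s \<in> {1..Suc t}. A s = a} = (if A (Suc t) = a then insert (Suc t) else id) {s \<in> {1..t}. A s = a}"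
  by (auto simp: le_Suc_eq)

lemma pulls_Suc: "pulls A a (Suc t) = pulls A a t + (if A (Suc t) = a then 1 else 0)"
  unfolding pulls_def rounds_Suc by simp

lemma pulls_mono: "s \<le> t \<Longrightarrow> pulls A a s \<le> pulls A a t"
  unfolding pulls_def by (intro card_mono) auto

lemma pulls_le: "pulls A a t \<le> t"
  by (induction t) (auto simp: pulls_Suc)

lemma sum_pulls:
  fixes A :: "nat \<Rightarrow> 'k::finite"
  shows "(\<Sum>a\<in>UNIV. pulls A a t) = t"
  by (induction t) (auto simp: pulls_Suc sum.distrib)

text \<open>Observations collected over rounds are an initial segment of the arm's own sequence, so
  adaptive sampling reduces to the law of large numbers along \<open>pulls A a t\<close>.\<close>

lemma sum_obs: "(\<Sum>s\<in>{s \<in> {1..t}. A s = a}. obs A X s) = (\<Sum>n<pulls A a t. X a n)"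
proof (induction t)
  case (Suc t)
  then show ?case
    unfolding rounds_Suc pulls_Suc by (auto simp: obs_def)
qed simp

lemma emp_mean_eq: "emp_mean A X a t = (\<Sum>n<pulls A a t. X a n) / real (pulls A a t)"
  by (simp only: emp_mean_def sum_obs)

text \<open>The product is the cost already spent on the arm; before the first pull both sides are
  zero.\<close>

lemma emp_mean_mult_pulls: "emp_mean A X a t * real (pulls A a t) = (\<Sum>n<pulls A a t. X a n)"
  by (simp add: emp_mean_eq)

lemma total_cost_eq:
  fixes A :: "nat \<Rightarrow> 'k::finite"
  shows "total_cost A Y t = (\<Sum>a\<in>UNIV. \<Sum>n<pulls A a t. Y a n)"
  unfolding total_cost_def sum_obs [symmetric]
  by (subst sum.group) auto

lemma ctas_rule_forced:
  fixes A :: "nat \<Rightarrow> 'k::finite"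
  assumes "ctas_rule W X Y A" "CARD('k) \<le> t" "real (pulls A a t) < sqrt (real t)"
  shows "pulls A (A (Suc t)) t \<le> pulls A b t"
  using assms unfolding ctas_rule_def Let_def by (auto split: if_splits)

lemma ctas_rule_tracking:
  fixes A :: "nat \<Rightarrow> 'k::finite"
  assumes "ctas_rule W X Y A" "CARD('k) \<le> t" "\<And>a. sqrt (real t) \<le> real (pulls A a t)"
  shows "total_cost A Y t * W (\<lambda>a. emp_mean A X a t) (\<lambda>a. emp_mean A Y a t) b - (\<Sum>n<pulls A b t. Y b n)
    \<le> total_cost A Y t * W (\<lambda>a. emp_mean A X a t) (\<lambda>a. emp_mean A Y a t) (A (Suc t))
       - (\<Sum>n<pulls A (A (Suc t)) t. Y (A (Suc t)) n)"
proof -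
  have "{a. real (pulls A a t) < sqrt (real t)} = {}" using assms(3) by (auto simp: not_less)
  then show ?thesis
    using assms(1,2) unfolding ctas_rule_def Let_def emp_mean_mult_pulls by simp
qed

text \<open>If arm \<open>a\<close> stayed below a bound \<open>B\<close>, eventually every round
  would be forced and would pull an arm with at most \<open>B\<close> pulls. All counts would then
  be bounded, although they sum to \<open>t\<close>.\<close>

lemma ctas_pulls_at_top:
  fixes A :: "nat \<Rightarrow> 'k::finite"
  assumes rule: "ctas_rule W X Y A"
  shows "filterlim (pulls A a) at_top sequentially"
proof -
  have "\<exists>t. B < pulls A a t" for B
  proof (rule ccontr)
    assume "\<not> ?thesis"
    then have B: "pulls A a t \<le> B" for t by (simp add: not_less)
    \<comment> \<open>From here on the rule is in force and the square root of the time exceeds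
      \<open>B\<close>.\<close>
    define T where "T = max CARD('k) ((B + 1)\<^sup>2)"
    have few: "pulls A (A (Suc t)) t \<le> B" if t: "T \<le> t" for t
    proof -
      have "real (B + 1) \<le> sqrt (real t)"
      proof (rule real_le_rsqrt)
        have "(B + 1)\<^sup>2 \<le> t" using t by (simp add: T_def)
        then have "real ((B + 1)\<^sup>2) \<le> real t" by (simp only: of_nat_le_iff)
        then show "(real (B + 1))\<^sup>2 \<le> real t" by (simp only: of_nat_power)
      qed
      then have "real (pulls A a t) < sqrt (real t)" using B[of t] by linarith
      then show ?thesis using ctas_rule_forced[OF rule, of t a a] t B[of t] by (simp add: T_def)
    qed
    have bound: "pulls A b t \<le> T + B + 1" if "T \<le> t" for b t
      using that
    proof (induction t rule: dec_induct)
      case base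
      then show ?case using pulls_le[of A b T] by simp
    next
      case (step t)
      then show ?case using few[of t] by (auto simp: pulls_Suc)
    qed
    define t where "t = T + CARD('k) * (T + B + 1) + 1"
    have "t = (\<Sum>b\<in>UNIV. pulls A b t)" by (simp only: sum_pulls)
    also have "\<dots> \<le> (\<Sum>b\<in>(UNIV :: 'k set). T + B + 1)" by (intro sum_mono bound) (simp add: t_def)
    also have "\<dots> = CARD('k) * (T + B + 1)" by simp
    finally show False by (simp add: t_def)
  qed note unb = this
  show ?thesis
    unfolding filterlim_at_top eventually_sequentially
  proof
    fix Z
    obtain t where "Z < pulls A a t" using unb by blast
    then show "\<exists>N. \<forall>n\<ge>N. Z \<le> pulls A a n"
      by (intro exI[of _ t]) (auto intro: order_trans[OF less_imp_le pulls_mono])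
  qed
qed

text \<open>An arm pulled by the tracking rule lies below its target since the deviations from the
  targets sum to zero; together with the sublinear forced exploration this bounds every share from
  above, and shares sum to one.\<close>
lemma tracking_converges:
  fixes S :: "'k::finite \<Rightarrow> nat \<Rightarrow> real"
  assumes J: "\<And>t. J t = (\<Sum>a\<in>UNIV. S a t)" and S_nonneg: "\<And>a t. 0 \<le> S a t"
    and J_lower: "0 < l" "\<And>t. l * real t \<le> J t"
    and stay: "\<And>a t. a \<noteq> A (Suc t) \<Longrightarrow> S a (Suc t) = S a t"
    and incr: "\<And>t. S (A (Suc t)) t \<le> S (A (Suc t)) (Suc t)" "\<And>t. S (A (Suc t)) (Suc t) \<le> S (A (Suc t)) t + 1"
    and rule: "\<forall>\<^sub>F t in sequentially. S (A (Suc t)) t \<le> sqrt (real t) \<or>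
      (\<forall>b. J t * v t b - S b t \<le> J t * v t (A (Suc t)) - S (A (Suc t)) t)"
    and v: "\<And>a. (\<lambda>t. v t a) \<longlonglongrightarrow> w a" "\<forall>\<^sub>F t in sequentially. (\<Sum>a\<in>UNIV. v t a) = 1"
    and w: "\<And>a. 0 \<le> w a" "(\<Sum>a\<in>UNIV. w a) = 1"
  shows "(\<lambda>t. S a t / J t) \<longlonglongrightarrow> w a"
proof -
  have J_nonneg: "0 \<le> J t" for t unfolding J by (intro sum_nonneg S_nonneg)
  have S_mono: "S a t \<le> S a (Suc t)" for a t using incr(1)[of t] stay[of a t] by (cases "a = A (Suc t)") auto
  have J_mono: "J t \<le> J (Suc t)" for t unfolding J by (intro sum_mono S_mono)
  have upper: "\<forall>\<^sub>F t in sequentially. S a t / J t < y" if y: "w a < y" for a y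
  proof -
    obtain z where z: "w a < z" "z < y" using dense[OF y] by blast
    define e where "e = z - w a"
    have e: "e > 0" "w a + e < y" using z by (simp_all add: e_def)
    have "\<forall>\<^sub>F t in sequentially. v t a < w a + e" using e by (intro order_tendstoD(2)[OF v(1)]) simp
    then have "\<forall>\<^sub>F t in sequentially. v t a < w a + e \<and> (\<Sum>a\<in>UNIV. v t a) = 1 \<and>
      (S (A (Suc t)) t \<le> sqrt (real t) \<or>
        (\<forall>b. J t * v t b - S b t \<le> J t * v t (A (Suc t)) - S (A (Suc t)) t))"
      using rule v(2) by eventually_elim blast
    then obtain T where T: "\<And>t. t \<ge> T \<Longrightarrow> v t a < w a + e" "\<And>t. t \<ge> T \<Longrightarrow> (\<Sum>a\<in>UNIV. v t a) = 1"
      "\<And>t. t \<ge> T \<Longrightarrow> S (A (Suc t)) t \<le> sqrt (real t) \<or>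
      (\<forall>b. J t * v t b - S b t \<le> J t * v t (A (Suc t)) - S (A (Suc t)) t)"
      unfolding eventually_sequentially by blast
    \<comment> \<open>Covers the starting value and the unit by which one pull may overshoot the
      bound.\<close>
    define C where "C = S a T + 1"
    have bound: "S a t \<le> (w a + e) * J t + (C + sqrt (real t))" if "T \<le> t" for t
      using that
    proof (induction t rule: dec_induct)
      case base
      then show ?case using w(1)[of a] e J_nonneg[of T] by (simp add: C_def)
    next
      case (step t)
      have mono: "(w a + e) * J t \<le> (w a + e) * J (Suc t)" "sqrt (real t) \<le> sqrt (real (Suc t))"
        using w(1)[of a] e J_mono[of t] by (auto intro: mult_left_mono)
      have nn: "0 \<le> (w a + e) * J t" "1 \<le> C" using w(1)[of a] e J_nonneg[of t] S_nonneg[of a T] by (auto simp: C_def)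
      show ?case
      proof (cases "a = A (Suc t)")
        case False
        then show ?thesis using stay[OF False] step.IH mono by linarith
      next
        case True
        have "S a t \<le> sqrt (real t) \<or> S a t \<le> (w a + e) * J t"
        proof (cases "S a t \<le> sqrt (real t)")
          case False
          then have max: "J t * v t b - S b t \<le> J t * v t a - S a t" for b
            using T(3)[OF step.hyps(1)] True by auto
          \<comment> \<open>The deviations from the targets sum to zero, so the largest one,
            attained by the arm pulled, is nonnegative.\<close>
          have "0 = (\<Sum>b\<in>UNIV. J t * v t b - S b t)"
            using T(2)[OF step.hyps(1)] by (simp add: sum_subtractf J flip: sum_distrib_left)
          also have "\<dots> \<le> (\<Sum>b\<in>(UNIV :: 'k set). J t * v t a - S a t)" by (intro sum_mono max)
          finally have "0 \<le> J t * v t a - S a t" by (simp add: zero_le_mult_iff)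
          also have "J t * v t a \<le> J t * (w a + e)"
            using T(1)[OF step.hyps(1)] J_nonneg[of t] by (intro mult_left_mono) auto
          finally show ?thesis by (simp add: mult.commute)
        qed simp
        moreover have "S a (Suc t) \<le> S a t + 1" using incr(2)[of t] True by simp
        moreover have "0 \<le> sqrt (real t)" by simp
        ultimately show ?thesis using mono nn by linarith
      qed
    qed
    have "(\<lambda>t. (C / real t + inverse (sqrt (real t))) / l) \<longlonglongrightarrow> (0 + 0) / l"
      by (intro tendsto_intros lim_const_over_n tendsto_inverse_0_at_top
          filterlim_compose[OF sqrt_at_top filterlim_real_sequentially]) (use J_lower in auto)
    then have "(\<lambda>t. (w a + e) + (C / real t + inverse (sqrt (real t))) / l) \<longlonglongrightarrow> (w a + e) + (0 + 0) / l"
      by (rule tendsto_add[OF tendsto_const])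
    then have "\<forall>\<^sub>F t in sequentially. (w a + e) + (C / real t + inverse (sqrt (real t))) / l < y"
      by (rule order_tendstoD(2)) (use e in simp)
    then show ?thesis
      using eventually_ge_at_top[of T] eventually_gt_at_top[of 0]
    proof eventually_elim
      case (elim t)
      have lt: "0 < l * real t" using elim J_lower by simp
      then have Jpos: "0 < J t" using J_lower(2)[of t] by linarith
      have Cnn: "0 \<le> C + sqrt (real t)" using S_nonneg[of a T] by (simp add: C_def)
      have "S a t / J t \<le> ((w a + e) * J t + (C + sqrt (real t))) / J t"
        using bound[OF elim(2)] Jpos by (intro divide_right_mono) auto
      also have "\<dots> = (w a + e) + (C + sqrt (real t)) / J t" using Jpos by (simp add: add_divide_distrib)
      also have "\<dots> \<le> (w a + e) + (C + sqrt (real t)) / (l * real t)"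
        using lt J_lower(2)[of t] Cnn by (intro add_left_mono divide_left_mono) auto
      also have "(C + sqrt (real t)) / (l * real t) = (C / real t + sqrt (real t) / real t) / l"
        using elim J_lower(1) by (simp add: field_simps)
      also have "sqrt (real t) / real t = inverse (sqrt (real t))" by (simp add: sqrt_divide_self_eq)
      finally show ?case using elim(1) by linarith
    qed
  qed
  show ?thesis
  proof (rule order_tendstoI)
    fix y assume y: "y < w a"
    \<comment> \<open>Each share exceeds its weight by less than \<open>e\<close>. As shares and
      weights both sum to one, the share of \<open>a\<close> cannot fall short by as much as
      \<open>w a - y\<close>.\<close>
    define e where "e = (w a - y) / real CARD('k)"
    have e: "e > 0" using y by (simp add: e_def)
    have "\<forall>\<^sub>F t in sequentially. \<forall>b. S b t / J t < w b + e"
      using e by (intro eventually_all_finite upper) simp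
    then show "\<forall>\<^sub>F t in sequentially. y < S a t / J t"
      using eventually_gt_at_top[of 0]
    proof eventually_elim
      case (elim t)
      have "0 < l * real t" using elim J_lower by simp
      then have Jpos: "0 < J t" using J_lower(2)[of t] by linarith
      have "(\<Sum>b\<in>UNIV. S b t / J t) = 1"
        using Jpos by (simp add: J flip: sum_divide_distrib)
      then have "(\<Sum>b\<in>UNIV. w b + e - S b t / J t) = real CARD('k) * e"
        using w(2) by (simp add: sum_subtractf sum.distrib)
      also have "\<dots> = w a - y" by (simp add: e_def)
      finally have total: "(\<Sum>b\<in>UNIV. w b + e - S b t / J t) = w a - y" .
      have "w a + e - S a t / J t \<le> (\<Sum>b\<in>UNIV. w b + e - S b t / J t)"
        by (intro member_le_sum) (use elim(1) in \<open>auto intro: less_imp_le\<close>)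
      then show ?case using total e by linarith
    qed
  qed (rule upper)
qed

text \<open>A deterministic statement about one sample path: randomness enters only through the
  convergence of the averages and the bounds on the costs.\<close>

lemma (in bandit_instance) ctas_shares_converge:
  fixes W :: "('k \<Rightarrow> real) \<Rightarrow> ('k \<Rightarrow> real) \<Rightarrow> 'k \<Rightarrow> real" and X Y :: "'k \<Rightarrow> nat \<Rightarrow> real"
  assumes W: "\<And>\<mu>' c'. (\<And>a. \<mu>' a \<in> I) \<Longrightarrow> unique_best \<mu>' \<Longrightarrow> (\<And>a. 0 < c' a) \<Longrightarrow>
      is_optimal_alloc d I \<mu>' c' (W \<mu>' c')"
    and X: "\<And>a. (\<lambda>n. (\<Sum>j<n. X a j) / real n) \<longlonglongrightarrow> \<mu> a"
    and Y: "\<And>a. (\<lambda>n. (\<Sum>j<n. Y a j) / real n) \<longlonglongrightarrow> c a"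
    and l: "0 < l" and Yb: "\<And>a n. Y a n \<in> {l..1}"
    and rule: "ctas_rule W X Y A"
  shows "(\<lambda>t. emp_mean A Y a t * real (pulls A a t) / total_cost A Y t) \<longlonglongrightarrow> W \<mu> c a"
proof -
  define S where "S a t = (\<Sum>n<pulls A a t. Y a n)" for a t
  define v where "v t = W (\<lambda>a. emp_mean A X a t) (\<lambda>a. emp_mean A Y a t)" for t
  have Y0: "0 \<le> Y a n" "Y a n \<le> 1" "l \<le> Y a n" for a n
    using Yb[of a n] l by auto
  have inst: "is_optimal_alloc d I \<mu>' c' (W \<mu>' c')" if "bandit_instance I \<theta> f d \<mu>' c' i" for \<mu>' c'
  proof -
    interpret B: bandit_instance I \<theta> f d \<mu>' c' i by (rule that)
    show ?thesis using W[OF B.\<mu>_I unique_bestI[of i \<mu>', OF B.best] B.c_pos] by simp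
  qed
  have emp: "(\<lambda>t. emp_mean A X a t) \<longlonglongrightarrow> \<mu> a" "(\<lambda>t. emp_mean A Y a t) \<longlonglongrightarrow> c a" for a
    unfolding emp_mean_eq
    by (rule filterlim_compose[OF X ctas_pulls_at_top[OF rule]]
             filterlim_compose[OF Y ctas_pulls_at_top[OF rule]])+
  \<comment> \<open>Early empirical means may tie or leave \<open>I\<close>, where \<open>W\<close>
    is arbitrary; the plug-in allocation is optimal only from some time on.\<close>
  have opt: "\<forall>\<^sub>F t in sequentially. is_optimal_alloc d I (\<lambda>a. emp_mean A X a t) (\<lambda>a. emp_mean A Y a t) (v t)"
    using eventually_bandit_instance[where \<mu>' = "\<lambda>t a. emp_mean A X a t" and c' = "\<lambda>t a. emp_mean A Y a t", OF emp]
    unfolding v_def by eventually_elim (rule inst)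
  have w: "is_optimal_alloc d I \<mu> c (W \<mu> c)" by (rule inst) unfold_locales
  have "(\<lambda>t. S a t / total_cost A Y t) \<longlonglongrightarrow> W \<mu> c a"
  proof (rule tracking_converges)
    show "total_cost A Y t = (\<Sum>a\<in>UNIV. S a t)" for t by (simp add: total_cost_eq S_def)
    show "0 \<le> S a t" for a t unfolding S_def by (intro sum_nonneg Y0)
    show "0 < l" by fact
    show "l * real t \<le> total_cost A Y t" for t
    proof -
      have "l * real t = real (\<Sum>a\<in>UNIV. pulls A a t) * l"
        by (simp only: sum_pulls mult.commute)
      also have "\<dots> = (\<Sum>a\<in>UNIV. real (pulls A a t) * l)"
        by (simp add: sum_distrib_right)
      also have "\<dots> = (\<Sum>a\<in>UNIV. \<Sum>n<pulls A a t. l)" by simp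
      also have "\<dots> \<le> total_cost A Y t" unfolding total_cost_eq by (intro sum_mono Y0)
      finally show ?thesis .
    qed
    show "S a (Suc t) = S a t" if "a \<noteq> A (Suc t)" for a t
      using that by (simp add: S_def pulls_Suc)
    show "S (A (Suc t)) t \<le> S (A (Suc t)) (Suc t)" "S (A (Suc t)) (Suc t) \<le> S (A (Suc t)) t + 1" for t
      using Y0 by (simp_all add: S_def pulls_Suc)
    show "\<forall>\<^sub>F t in sequentially. S (A (Suc t)) t \<le> sqrt (real t) \<or>
      (\<forall>b. total_cost A Y t * v t b - S b t \<le> total_cost A Y t * v t (A (Suc t)) - S (A (Suc t)) t)"
      using eventually_ge_at_top[of "CARD('k)"]
    proof eventually_elim
      case (elim t)
      show ?case
      proof (cases "\<exists>b. real (pulls A b t) < sqrt (real t)")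
        case True
        then obtain b where b: "real (pulls A b t) < sqrt (real t)" by blast
        \<comment> \<open>Costs are at most one, so the spent cost is at most the pull count, which
          in a forced round is minimal and below the square root of the time.\<close>
        have "S (A (Suc t)) t \<le> (\<Sum>n<pulls A (A (Suc t)) t. 1)" unfolding S_def by (intro sum_mono Y0)
        also have "\<dots> = real (pulls A (A (Suc t)) t)" by simp
        also have "\<dots> \<le> real (pulls A b t)" using ctas_rule_forced[OF rule elim b] by simp
        finally show ?thesis using b by linarith
      next
        case False
        then have "sqrt (real t) \<le> real (pulls A b t)" for b by (simp add: not_less)
        then show ?thesis
          using ctas_rule_tracking[OF rule elim] unfolding S_def v_def by blast
      qed
    qed
    show "(\<lambda>t. v t b) \<longlonglongrightarrow> W \<mu> c b" for b
      by (rule optimal_continuous[OF emp opt w])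
    show "\<forall>\<^sub>F t in sequentially. (\<Sum>a\<in>UNIV. v t a) = 1"
      using opt by eventually_elim (simp add: is_optimal_alloc_def prob_simplex_def)
    show "0 \<le> W \<mu> c b" for b using w by (simp add: is_optimal_alloc_def prob_simplex_def)
    show "(\<Sum>a\<in>UNIV. W \<mu> c a) = 1" using w by (simp add: is_optimal_alloc_def prob_simplex_def)
  qed
  then show ?thesis by (simp only: emp_mean_mult_pulls S_def)
qed

section \<open>Almost sure convergence of the cost shares\<close>

theorem theorem5:
  fixes M :: "'w measure" and \<rho> :: "real measure" and h b \<theta> :: "real \<Rightarrow> real"
    and I :: "real set" and \<mu> c :: "'k::finite \<Rightarrow> real" and lmin :: real
    and X Y :: "'k \<Rightarrow> nat \<Rightarrow> 'w \<Rightarrow> real"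
    and W :: "('k \<Rightarrow> real) \<Rightarrow> ('k \<Rightarrow> real) \<Rightarrow> ('k \<Rightarrow> real)"
    and A :: "'w \<Rightarrow> nat \<Rightarrow> 'k" and a :: 'k
  assumes "prob_space M"
    and "CARD('k) \<ge> 2"
    and "mean_param_nef \<rho> h b \<theta> I"
    and "\<forall>a. \<mu> a \<in> {0..1} \<inter> I"
    and "unique_best \<mu>"
    and "0 < lmin"
    and "\<forall>a n. X a n \<in> borel_measurable M \<and> Y a n \<in> borel_measurable M"
    and "\<forall>a n. distr M borel (X a n) = nef_measure \<rho> h b \<theta> (\<mu> a)"
    and "\<forall>a n. distr M borel (Y a n) = distr M borel (Y a 0)"
    and "\<forall>a n. AE \<omega> in M. Y a n \<omega> \<in> {lmin..1}"
    and "\<forall>a n. integral\<^sup>L M (Y a n) = c a"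
    and "prob_space.indep_vars M (\<lambda>_. borel) (\<lambda>(a, n) \<omega>. (X a n \<omega>, Y a n \<omega>)) UNIV"
    and "\<forall>\<mu>' c'. (\<forall>a. \<mu>' a \<in> I) \<and> unique_best \<mu>' \<and> (\<forall>a. 0 < c' a) \<longrightarrow>
            is_optimal_alloc (nef_kl \<rho> h b \<theta>) I \<mu>' c' (W \<mu>' c')"
    and "\<forall>\<omega>\<in>space M. ctas_rule W (\<lambda>a n. X a n \<omega>) (\<lambda>a n. Y a n \<omega>) (A \<omega>)"
  shows "AE \<omega> in M.
           (\<lambda>t. emp_mean (A \<omega>) (\<lambda>a n. Y a n \<omega>) a t * real (pulls (A \<omega>) a t)
                 / total_cost (A \<omega>) (\<lambda>a n. Y a n \<omega>) t)
           \<longlonglongrightarrow> W \<mu> c a"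
proof -
  interpret prob_space M by (rule assms(1))
  interpret mean_nef \<rho> h b \<theta> I by unfold_locales (rule assms(3))
  have Y_meas [measurable]: "Y a n \<in> borel_measurable M" for a n using assms(7) by blast
  have \<mu>_I: "\<mu> a \<in> I" for a using assms(4) by blast
  have Y_int: "integrable M (Y a n)" for a n
  proof (rule integrable_const_bound[of _ 1])
    show "AE \<omega> in M. norm (Y a n \<omega>) \<le> 1"
      using assms(10)[rule_format, of a n] by eventually_elim (use assms(6) in auto)
  qed simp
  have c_pos: "0 < c a" for a
  proof -
    have "expectation (\<lambda>_. lmin) \<le> expectation (Y a 0)"
      using assms(10)[rule_format, of a 0] by (intro integral_mono_AE Y_int) (auto elim: eventually_mono)
    then show ?thesis using assms(6,11) by (simp add: prob_space)
  qed
  have inst: "bandit_instance I \<theta> f (nef_kl \<rho> h b \<theta>) \<mu> c (best_arm \<mu>)"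
    unfolding bandit_instance_def bandit_instance_axioms_def
    using bregman \<mu>_I c_pos assms(2) best_arm_less[OF assms(5)] by blast
  have indep: "indep_vars (\<lambda>_. borel) (X a) UNIV \<and> indep_vars (\<lambda>_. borel) (Y a) UNIV" for a
  proof -
    \<comment> \<open>Restricting to one arm, reindexing by the pull number and projecting gives
      independence in time of rewards and of costs separately; reward and cost of one pull may be
      dependent.\<close>
    have "indep_vars (\<lambda>_. borel) (\<lambda>(a, n) \<omega>. (X a n \<omega>, Y a n \<omega>)) (Pair a ` UNIV)"
      by (rule indep_vars_subset[OF assms(12)]) simp
    then have "indep_vars (\<lambda>_. borel) (\<lambda>n \<omega>. (X a n \<omega>, Y a n \<omega>)) UNIV"
      by (drule_tac indep_vars_reindex) (auto intro: inj_onI)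
    from indep_vars_compose2[OF this, of "\<lambda>_. fst" "\<lambda>_. borel"]
      indep_vars_compose2[OF this, of "\<lambda>_. snd" "\<lambda>_. borel"]
    show ?thesis
      by (simp add: borel_measurable_continuous_onI continuous_on_fst continuous_on_snd)
  qed
  have "AE \<omega> in M. \<forall>a. (\<lambda>n. (\<Sum>j<n. X a j \<omega>) / real n) \<longlonglongrightarrow> \<mu> a"
    by (subst AE_all_countable, intro allI AE_average_tendsto)
       (use prob_space_axioms indep assms(8) \<mu>_I in auto)
  moreover have "AE \<omega> in M. \<forall>a. (\<lambda>n. (\<Sum>j<n. Y a j \<omega>) / real n) \<longlonglongrightarrow> c a"
  proof (subst AE_all_countable, intro allI AE_average_tendsto_unit_interval)
    fix a n
    show "AE \<omega> in M. Y a n \<omega> \<in> {0..1}"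
      using assms(10)[rule_format, of a n] by eventually_elim (use assms(6) in auto)
  qed (use indep assms(11) in auto)
  moreover have "AE \<omega> in M. \<forall>a n. Y a n \<omega> \<in> {lmin..1}"
    using assms(10) by (simp only: AE_all_countable simp_thms)
  ultimately show ?thesis
    using AE_space
  proof eventually_elim
    case (elim \<omega>)
    show ?case
      by (rule bandit_instance.ctas_shares_converge[OF inst, of W "\<lambda>a n. X a n \<omega>" "\<lambda>a n. Y a n \<omega>" lmin])
         (use elim assms(6,13,14) in auto)
  qed
qed

end
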